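(* Let $\mathbb{F}_2$ be the free group of rank $2$ and let $\mathbb{F}_2\operatorname{wr}\mathbb{Z}$ be the restricted wreath product. The poset $\mathcal{H}_{qp}(\mathbb{F}_2\operatorname{wr}\mathbb{Z})$ contains an isomorphic copy of the poset $\mathbb{P}(\mathbb{N})$ of all subsets of $\mathbb{N}$ ordered by inclusion. In particular, $\mathcal{H}_{qp}(\mathbb{F}_2\operatorname{wr}\mathbb{Z})$ contains an uncountable chain.
   Context: For a group $\Gamma$ and (possibly infinite) generating sets $X,Y$ of $\Gamma$, write $X\preceq Y$ if $\sup_{y\in Y}|y|_X<\infty$, where $|\cdot|_X$ is word length with respect to $X\cup X^{-1}$. $X\sim Y$ if $X\preceq Y$ and $Y\preceq X$; $[X]$ is the equivalence class; $[X]\preccurlyeq[Y]$ iff $X\preceq Y$. A hyperbolic structure on $\Gamma$ is a class $[X]$ such that the Cayley graph of $\Gamma$ with respect to $X$ is Gromov hyperbolic. It is quasi-parabolic if, for the action of $\Gamma$ by left multiplication on this Cayley graph, the set of limit points of an orbit on the Gromov boundary is infinite and $\Gamma$ fixes a point of the boundary. $\mathcal{H}_{qp}(\Gamma)$ is the set of quasi-parabolic structures on $\Gamma$, ordered by $\preccurlyeq$. A poset $Q$ contains an isomorphic copy of a poset $P$ if there is an injective map $P\to Q$ that preserves and reflects the order. *)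

theory Defs
  imports Complex_Main
    "HOL-Algebra.Generated_Groups" "HOL-Algebra.Group_Action" "HOL-Algebra.Elementary_Groups"
    "HOL-Library.Countable_Set"
begin

section \<open>Free groups and restricted wreath products\<close>

text \<open>The free group on \<open>S\<close> is realised by reduced words. The letter \<open>(s, True)\<close> stands for
  the generator \<open>s\<close> and \<open>(s, False)\<close> for its formal inverse.\<close>

definition letter_inv :: "'s \<times> bool \<Rightarrow> 's \<times> bool"
  where "letter_inv l = (fst l, \<not> snd l)"

definition reduced_words :: "'s set \<Rightarrow> ('s \<times> bool) list set"
  where "reduced_words S =
    {w. set w \<subseteq> S \<times> UNIV \<and> successively (\<lambda>k l. l \<noteq> letter_inv k) w}"

fun push_letter :: "'s \<times> bool \<Rightarrow> ('s \<times> bool) list \<Rightarrow> ('s \<times> bool) list"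
  where
    "push_letter l [] = [l]"
  | "push_letter l (k # w) = (if k = letter_inv l then w else l # k # w)"

definition free_group :: "'s set \<Rightarrow> ('s \<times> bool) list monoid"
  where "free_group S =
    \<lparr>carrier = reduced_words S, monoid.mult = foldr push_letter, one = []\<rparr>"

text \<open>Elements are pairs \<open>(f, h)\<close> with \<open>f : H \<rightarrow> G\<close> finitely supported, multiplied by
  \<open>(f, h) (f', h') = (f \<cdot> (h f'), h h')\<close>, where \<open>(h f') x = f' (h\<inverse> x)\<close>.\<close>

definition restricted_wreath ::
    "('a, 'm) monoid_scheme \<Rightarrow> ('b, 'n) monoid_scheme \<Rightarrow> (('b \<Rightarrow> 'a) \<times> 'b) monoid"
  where "restricted_wreath G H =
    \<lparr>carrier = {f \<in> carrier H \<rightarrow>\<^sub>E carrier G. finite {x \<in> carrier H. f x \<noteq> \<one>\<^bsub>G\<^esub>}}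
                 \<times> carrier H,
     monoid.mult = (\<lambda>(f, h) (f', h').
       (\<lambda>x\<in>carrier H. f x \<otimes>\<^bsub>G\<^esub> f' (inv\<^bsub>H\<^esub> h \<otimes>\<^bsub>H\<^esub> x), h \<otimes>\<^bsub>H\<^esub> h')),
     one = (\<lambda>x\<in>carrier H. \<one>\<^bsub>G\<^esub>, \<one>\<^bsub>H\<^esub>)\<rparr>"


section \<open>Gromov hyperbolicity and the Gromov boundary\<close>

definition gromov_product :: "('m \<Rightarrow> 'm \<Rightarrow> real) \<Rightarrow> 'm \<Rightarrow> 'm \<Rightarrow> 'm \<Rightarrow> real"
  where "gromov_product d p x y = (d p x + d p y - d x y) / 2"

definition gromov_hyperbolic :: "'m set \<Rightarrow> ('m \<Rightarrow> 'm \<Rightarrow> real) \<Rightarrow> bool"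
  where "gromov_hyperbolic M d \<longleftrightarrow>
    (\<exists>\<delta>\<ge>0. \<forall>p\<in>M. \<forall>x\<in>M. \<forall>y\<in>M. \<forall>z\<in>M.
       gromov_product d p x z \<ge> min (gromov_product d p x y) (gromov_product d p y z) - \<delta>)"

text \<open>The Gromov boundary is the sequential one, since the spaces below need not be proper.
  The point \<open>p\<close> is a base point in \<open>M\<close>; the choice is immaterial.\<close>

definition gromov_sequences :: "'m set \<Rightarrow> ('m \<Rightarrow> 'm \<Rightarrow> real) \<Rightarrow> 'm \<Rightarrow> (nat \<Rightarrow> 'm) set"
  where "gromov_sequences M d p =
    {x. range x \<subseteq> M \<and> (\<forall>K. \<exists>N. \<forall>i\<ge>N. \<forall>j\<ge>N. gromov_product d p (x i) (x j) \<ge> K)}"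

definition gromov_rel ::
    "'m set \<Rightarrow> ('m \<Rightarrow> 'm \<Rightarrow> real) \<Rightarrow> 'm \<Rightarrow> ((nat \<Rightarrow> 'm) \<times> (nat \<Rightarrow> 'm)) set"
  where "gromov_rel M d p =
    {(x, y). x \<in> gromov_sequences M d p \<and> y \<in> gromov_sequences M d p \<and>
       (\<forall>K. \<exists>N. \<forall>i\<ge>N. \<forall>j\<ge>N. gromov_product d p (x i) (y j) \<ge> K)}"

definition gromov_boundary ::
    "'m set \<Rightarrow> ('m \<Rightarrow> 'm \<Rightarrow> real) \<Rightarrow> 'm \<Rightarrow> (nat \<Rightarrow> 'm) set set"
  where "gromov_boundary M d p = gromov_sequences M d p // gromov_rel M d p"

definition limit_points ::
    "'m set \<Rightarrow> ('m \<Rightarrow> 'm \<Rightarrow> real) \<Rightarrow> 'm \<Rightarrow> 'm set \<Rightarrow> (nat \<Rightarrow> 'm) set set"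
  where "limit_points M d p S = {\<xi> \<in> gromov_boundary M d p. \<exists>x\<in>\<xi>. range x \<subseteq> S}"

definition boundary_map :: "('m \<Rightarrow> 'm) \<Rightarrow> (nat \<Rightarrow> 'm) set \<Rightarrow> (nat \<Rightarrow> 'm) set"
  where "boundary_map f \<xi> = (\<lambda>x. f \<circ> x) ` \<xi>"


section \<open>Generating sets and Cayley graphs\<close>

context
  fixes G :: "('a, 'b) monoid_scheme" (structure)
begin

definition generating_sets :: "'a set set"
  where "generating_sets = {X. X \<subseteq> carrier G \<and> generate G X = carrier G}"

definition sym_closure :: "'a set \<Rightarrow> 'a set"
  where "sym_closure X = X \<union> (\<lambda>x. inv x) ` X"

definition word_length :: "'a set \<Rightarrow> 'a \<Rightarrow> nat"
  where "word_length X g =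
    (LEAST n. \<exists>w. length w = n \<and> set w \<subseteq> sym_closure X \<and> foldr (\<otimes>) w \<one> = g)"

definition gen_le :: "'a set \<Rightarrow> 'a set \<Rightarrow> bool"
  where "gen_le X Y \<longleftrightarrow> bdd_above (word_length X ` Y)"

definition gen_equiv :: "'a set rel"
  where "gen_equiv =
    {(X, Y). X \<in> generating_sets \<and> Y \<in> generating_sets \<and> gen_le X Y \<and> gen_le Y X}"

definition gen_class :: "'a set \<Rightarrow> 'a set set"
  where "gen_class X = gen_equiv `` {X}"

text \<open>The Cayley graph is treated as a metric space in the usual way: its points are the
  vertices, that is, the elements of \<open>carrier G\<close>, at the distance given by the minimal number
  of edges in an edge path.\<close>

definition cayley_edges :: "'a set \<Rightarrow> 'a rel"
  where "cayley_edges X = {(g, g \<otimes> s) | g s. g \<in> carrier G \<and> s \<in> sym_closure X}"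

definition cayley_dist :: "'a set \<Rightarrow> 'a \<Rightarrow> 'a \<Rightarrow> real"
  where "cayley_dist X g h = real (LEAST n. (g, h) \<in> cayley_edges X ^^ n)"

definition left_translation :: "'a \<Rightarrow> 'a \<Rightarrow> 'a"
  where "left_translation g = (\<lambda>h\<in>carrier G. g \<otimes> h)"

definition hyperbolic_generating_set :: "'a set \<Rightarrow> bool"
  where "hyperbolic_generating_set X \<longleftrightarrow>
    X \<in> generating_sets \<and> gromov_hyperbolic (carrier G) (cayley_dist X)"

definition quasi_parabolic_generating_set :: "'a set \<Rightarrow> bool"
  where "quasi_parabolic_generating_set X \<longleftrightarrow>
    hyperbolic_generating_set X \<and>
    infinite (limit_points (carrier G) (cayley_dist X) \<one> (orbit G left_translation \<one>)) \<and>
    (\<exists>\<xi>\<in>gromov_boundary (carrier G) (cayley_dist X) \<one>.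
       \<forall>g\<in>carrier G. boundary_map (left_translation g) \<xi> = \<xi>)"

definition hyperbolic_structures :: "'a set set set"
  where "hyperbolic_structures = {gen_class X | X. hyperbolic_generating_set X}"

definition quasi_parabolic_structures :: "'a set set set"
  where "quasi_parabolic_structures = {gen_class X | X. quasi_parabolic_generating_set X}"

definition structure_le :: "'a set set \<Rightarrow> 'a set set \<Rightarrow> bool"
  where "structure_le A B \<longleftrightarrow> (\<exists>X\<in>A. \<exists>Y\<in>B. gen_le X Y)"

end


section \<open>Posets\<close>

text \<open>Here a poset is given by its underlying set together with its order predicate.\<close>

definition contains_isomorphic_copy ::
    "'q set \<Rightarrow> ('q \<Rightarrow> 'q \<Rightarrow> bool) \<Rightarrow> 'p set \<Rightarrow> ('p \<Rightarrow> 'p \<Rightarrow> bool) \<Rightarrow> bool"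
  where "contains_isomorphic_copy Q leQ P leP \<longleftrightarrow>
    (\<exists>f \<in> P \<rightarrow> Q. inj_on f P \<and> (\<forall>x\<in>P. \<forall>y\<in>P. leQ (f x) (f y) \<longleftrightarrow> leP x y))"


section \<open>Basic facts\<close>

subsection \<open>The free group is a group\<close>

lemma letter_inv_inv [simp]: "letter_inv (letter_inv l) = l"
  by (simp add: letter_inv_def)

lemma letter_inv_neq [simp]: "letter_inv l \<noteq> l" "l \<noteq> letter_inv l"
  by (auto simp: letter_inv_def prod_eq_iff)

lemma push_letter_reduced:
  assumes "l \<in> S \<times> UNIV" "w \<in> reduced_words S"
  shows "push_letter l w \<in> reduced_words S"
  using assms by (cases w) (auto simp: reduced_words_def successively_Cons)

lemma push_letter_cancel:
  assumes "w \<in> reduced_words S"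
  shows "push_letter l (push_letter (letter_inv l) w) = w"
proof (cases w)
  case (Cons k v)
  show ?thesis
  proof (cases "k = l")
    case True
    then show ?thesis using assms Cons
      by (cases v) (auto simp: reduced_words_def)
  qed (use Cons in auto)
qed auto

lemma foldr_push_reduced:
  assumes "set u \<subseteq> S \<times> UNIV" "w \<in> reduced_words S"
  shows "foldr push_letter u w \<in> reduced_words S"
  using assms by (induction u) (auto intro!: push_letter_reduced)

lemma foldr_push_letter:
  assumes "w \<in> reduced_words S"
    and "set u \<subseteq> S \<times> UNIV"
  shows "foldr push_letter (push_letter l u) w = push_letter l (foldr push_letter u w)"
proof (cases u)
  case (Cons k v)
  show ?thesis
  proof (cases "k = letter_inv l")
    case True
    have "foldr push_letter v w \<in> reduced_words S"
      using assms Cons by (intro foldr_push_reduced) auto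
    then have "push_letter l (push_letter (letter_inv l) (foldr push_letter v w)) =
        foldr push_letter v w" by (rule push_letter_cancel)
    then show ?thesis using Cons True by simp
  qed (use Cons in auto)
qed auto

lemma foldr_push_assoc:
  assumes "set u \<subseteq> S \<times> UNIV" "v \<in> reduced_words S" "w \<in> reduced_words S"
  shows "foldr push_letter (foldr push_letter u v) w = foldr push_letter u (foldr push_letter v w)"
  using assms(1)
proof (induction u)
  case (Cons l u)
  then have "foldr push_letter u v \<in> reduced_words S"
    using assms by (intro foldr_push_reduced) auto
  then have "set (foldr push_letter u v) \<subseteq> S \<times> UNIV"
    by (auto simp: reduced_words_def)
  then show ?case using Cons foldr_push_letter[OF assms(3)] by auto
qed auto

lemma foldr_push_Nil:
  assumes "w \<in> reduced_words S"
  shows "foldr push_letter w [] = w"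
  using assms
proof (induction w)
  case (Cons l w)
  then have "w \<in> reduced_words S" by (auto simp: reduced_words_def successively_Cons)
  then show ?case using Cons by (cases w) (auto simp: reduced_words_def)
qed auto

lemma foldr_push_inverse:
  assumes "set w \<subseteq> S \<times> UNIV" "v \<in> reduced_words S"
  shows "foldr push_letter (rev (map letter_inv w)) (foldr push_letter w v) = v"
  using assms
proof (induction w arbitrary: v)
  case (Cons l w)
  have "foldr push_letter w v \<in> reduced_words S"
    using Cons by (intro foldr_push_reduced) auto
  then show ?case using Cons push_letter_cancel[of _ S "letter_inv l"] by auto
qed auto

lemma group_free_group: "group (free_group S)"
proof (rule groupI)
  fix w assume "w \<in> carrier (free_group S)"
  then have w: "w \<in> reduced_words S" "set w \<subseteq> S \<times> UNIV"
    by (auto simp: free_group_def reduced_words_def)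
  define w' where "w' = foldr push_letter (rev (map letter_inv w)) []"
  have Nil: "[] \<in> reduced_words S" by (simp add: reduced_words_def)
  have inv_letters: "set (rev (map letter_inv w)) \<subseteq> S \<times> UNIV"
    using w(2) by (auto simp: letter_inv_def)
  have "w' \<in> reduced_words S"
    unfolding w'_def by (rule foldr_push_reduced[OF inv_letters Nil])
  moreover have "foldr push_letter w' w = []"
    unfolding w'_def foldr_push_assoc[OF inv_letters Nil w(1)]
    using foldr_push_inverse[OF w(2) Nil] foldr_push_Nil[OF w(1)] by simp
  ultimately show "\<exists>y\<in>carrier (free_group S). y \<otimes>\<^bsub>free_group S\<^esub> w = \<one>\<^bsub>free_group S\<^esub>"
    by (auto simp: free_group_def)
next
  fix u v w
  assume "u \<in> carrier (free_group S)" "v \<in> carrier (free_group S)" "w \<in> carrier (free_group S)"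
  then show "u \<otimes>\<^bsub>free_group S\<^esub> v \<otimes>\<^bsub>free_group S\<^esub> w = u \<otimes>\<^bsub>free_group S\<^esub> (v \<otimes>\<^bsub>free_group S\<^esub> w)"
    using foldr_push_assoc[of u S v w] by (auto simp: free_group_def reduced_words_def)
next
  fix u v assume "u \<in> carrier (free_group S)" "v \<in> carrier (free_group S)"
  then show "u \<otimes>\<^bsub>free_group S\<^esub> v \<in> carrier (free_group S)"
    using foldr_push_reduced[of u S v] by (auto simp: free_group_def reduced_words_def)
qed (auto simp: free_group_def reduced_words_def)

subsection \<open>The restricted wreath product is a group\<close>

lemma group_restricted_wreath:
  fixes G :: "('a, 'm) monoid_scheme" and H :: "('b, 'n) monoid_scheme"
  assumes "group G" "group H"
  shows "group (restricted_wreath G H)"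
proof -
  interpret G: group G by fact
  interpret H: group H by fact
  let ?F = "{f \<in> carrier H \<rightarrow>\<^sub>E carrier G. finite {x \<in> carrier H. f x \<noteq> \<one>\<^bsub>G\<^esub>}}"
  have shift: "finite {x \<in> carrier H. f (inv\<^bsub>H\<^esub> h \<otimes>\<^bsub>H\<^esub> x) \<noteq> \<one>\<^bsub>G\<^esub>}"
    if "f \<in> ?F" "h \<in> carrier H" for f h
  proof (rule finite_surj)
    show "finite {x \<in> carrier H. f x \<noteq> \<one>\<^bsub>G\<^esub>}" using that by simp
    show "{x \<in> carrier H. f (inv\<^bsub>H\<^esub> h \<otimes>\<^bsub>H\<^esub> x) \<noteq> \<one>\<^bsub>G\<^esub>}
      \<subseteq> (\<lambda>y. h \<otimes>\<^bsub>H\<^esub> y) ` {x \<in> carrier H. f x \<noteq> \<one>\<^bsub>G\<^esub>}"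
    proof
      fix x assume x: "x \<in> {x \<in> carrier H. f (inv\<^bsub>H\<^esub> h \<otimes>\<^bsub>H\<^esub> x) \<noteq> \<one>\<^bsub>G\<^esub>}"
      then have "x = h \<otimes>\<^bsub>H\<^esub> (inv\<^bsub>H\<^esub> h \<otimes>\<^bsub>H\<^esub> x)"
        using that(2) by (simp add: H.m_assoc[symmetric])
      then show "x \<in> (\<lambda>y. h \<otimes>\<^bsub>H\<^esub> y) ` {x \<in> carrier H. f x \<noteq> \<one>\<^bsub>G\<^esub>}"
        using x that(2) by (intro image_eqI) auto
    qed
  qed
  have mult_closed: "(\<lambda>x\<in>carrier H. f x \<otimes>\<^bsub>G\<^esub> f' (inv\<^bsub>H\<^esub> h \<otimes>\<^bsub>H\<^esub> x)) \<in> ?F"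
    if "f \<in> ?F" "f' \<in> ?F" "h \<in> carrier H" for f f' h
  proof -
    have "{x \<in> carrier H. (\<lambda>x\<in>carrier H. f x \<otimes>\<^bsub>G\<^esub> f' (inv\<^bsub>H\<^esub> h \<otimes>\<^bsub>H\<^esub> x)) x \<noteq> \<one>\<^bsub>G\<^esub>}
      \<subseteq> {x \<in> carrier H. f x \<noteq> \<one>\<^bsub>G\<^esub>} \<union> {x \<in> carrier H. f' (inv\<^bsub>H\<^esub> h \<otimes>\<^bsub>H\<^esub> x) \<noteq> \<one>\<^bsub>G\<^esub>}"
      by auto
    then have "finite {x \<in> carrier H. (\<lambda>x\<in>carrier H. f x \<otimes>\<^bsub>G\<^esub> f' (inv\<^bsub>H\<^esub> h \<otimes>\<^bsub>H\<^esub> x)) x \<noteq> \<one>\<^bsub>G\<^esub>}"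
      by (rule finite_subset) (use that shift[OF that(2,3)] in auto)
    moreover have "(\<lambda>x\<in>carrier H. f x \<otimes>\<^bsub>G\<^esub> f' (inv\<^bsub>H\<^esub> h \<otimes>\<^bsub>H\<^esub> x)) \<in> carrier H \<rightarrow>\<^sub>E carrier G"
      using that by (intro restrict_PiE[THEN iffD2] Pi_I) (auto simp: PiE_def Pi_def)
    ultimately show ?thesis by blast
  qed
  show ?thesis
  proof (rule groupI)
    fix a b assume "a \<in> carrier (restricted_wreath G H)" "b \<in> carrier (restricted_wreath G H)"
    then show "a \<otimes>\<^bsub>restricted_wreath G H\<^esub> b \<in> carrier (restricted_wreath G H)"
      using mult_closed by (cases a; cases b) (simp add: restricted_wreath_def)
  next
    show "\<one>\<^bsub>restricted_wreath G H\<^esub> \<in> carrier (restricted_wreath G H)"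
      by (auto simp: restricted_wreath_def)
  next
    fix a b c
    assume "a \<in> carrier (restricted_wreath G H)" "b \<in> carrier (restricted_wreath G H)"
      "c \<in> carrier (restricted_wreath G H)"
    then show "a \<otimes>\<^bsub>restricted_wreath G H\<^esub> b \<otimes>\<^bsub>restricted_wreath G H\<^esub> c =
      a \<otimes>\<^bsub>restricted_wreath G H\<^esub> (b \<otimes>\<^bsub>restricted_wreath G H\<^esub> c)"
      by (auto simp: restricted_wreath_def H.m_assoc H.inv_mult_group PiE_def Pi_def G.m_assoc
          intro!: restrict_ext)
  next
    fix a assume "a \<in> carrier (restricted_wreath G H)"
    then show "\<one>\<^bsub>restricted_wreath G H\<^esub> \<otimes>\<^bsub>restricted_wreath G H\<^esub> a = a"
      by (auto simp: restricted_wreath_def PiE_def Pi_def extensional_def restrict_def)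
  next
    fix a assume a: "a \<in> carrier (restricted_wreath G H)"
    obtain f h where fh: "a = (f, h)" by (cases a)
    have f: "f \<in> ?F" and h: "h \<in> carrier H" using a fh by (auto simp: restricted_wreath_def)
    have val: "f x \<in> carrier G" if "x \<in> carrier H" for x using f that by (auto simp: PiE_def Pi_def)
    define f' where "f' = (\<lambda>x\<in>carrier H. inv\<^bsub>G\<^esub> f (h \<otimes>\<^bsub>H\<^esub> x))"
    have "finite {x \<in> carrier H. f (h \<otimes>\<^bsub>H\<^esub> x) \<noteq> \<one>\<^bsub>G\<^esub>}"
      using shift[OF f, of "inv\<^bsub>H\<^esub> h"] h by simp
    moreover have "{x \<in> carrier H. f' x \<noteq> \<one>\<^bsub>G\<^esub>} \<subseteq> {x \<in> carrier H. f (h \<otimes>\<^bsub>H\<^esub> x) \<noteq> \<one>\<^bsub>G\<^esub>}"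
      by (auto simp: f'_def)
    ultimately have "finite {x \<in> carrier H. f' x \<noteq> \<one>\<^bsub>G\<^esub>}" by (rule rev_finite_subset)
    moreover have "f' \<in> carrier H \<rightarrow>\<^sub>E carrier G" using val h by (auto simp: f'_def)
    ultimately have "(f', inv\<^bsub>H\<^esub> h) \<in> carrier (restricted_wreath G H)"
      using h by (simp add: restricted_wreath_def)
    moreover have "(f', inv\<^bsub>H\<^esub> h) \<otimes>\<^bsub>restricted_wreath G H\<^esub> a = \<one>\<^bsub>restricted_wreath G H\<^esub>"
      using val h by (auto simp: restricted_wreath_def fh f'_def intro!: restrict_ext)
    ultimately show "\<exists>b\<in>carrier (restricted_wreath G H).
        b \<otimes>\<^bsub>restricted_wreath G H\<^esub> a = \<one>\<^bsub>restricted_wreath G H\<^esub>" by blast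
  qed
qed

subsection \<open>The order on structures\<close>

context group
begin

lemma sym_closure_carrier: "X \<subseteq> carrier G \<Longrightarrow> sym_closure G X \<subseteq> carrier G"
  by (auto simp: sym_closure_def)

lemma foldr_mult_closed: "set w \<subseteq> carrier G \<Longrightarrow> foldr (\<otimes>) w \<one> \<in> carrier G"
  by (induction w) auto

lemma foldr_mult_append:
  "set u \<subseteq> carrier G \<Longrightarrow> set v \<subseteq> carrier G \<Longrightarrow>
    foldr (\<otimes>) (u @ v) \<one> = foldr (\<otimes>) u \<one> \<otimes> foldr (\<otimes>) v \<one>"
  by (induction u) (auto simp: foldr_mult_closed m_assoc simp del: foldr_append)

lemma foldr_mult_inv:
  assumes "set u \<subseteq> carrier G"
  shows "foldr (\<otimes>) (rev (map (\<lambda>x. inv x) u)) \<one> = inv (foldr (\<otimes>) u \<one>)"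
  using assms
proof (induction u)
  case (Cons a u)
  then have "set (rev (map (\<lambda>x. inv x) u)) \<subseteq> carrier G" by auto
  then show ?case
    using Cons foldr_mult_append[of "rev (map (\<lambda>x. inv x) u)" "[inv a]"]
    by (simp add: inv_mult_group foldr_mult_closed del: foldr_append)
qed auto

lemma word_exists:
  assumes "X \<in> generating_sets G" "g \<in> carrier G"
  shows "\<exists>w. set w \<subseteq> sym_closure G X \<and> foldr (\<otimes>) w \<one> = g"
proof -
  have X: "X \<subseteq> carrier G" using assms by (auto simp: generating_sets_def)
  have "g \<in> generate G X" using assms by (auto simp: generating_sets_def)
  then show ?thesis
  proof induction
    case one
    show ?case by (rule exI[of _ "[]"]) auto
  next
    case (incl h)
    then show ?case using X by (intro exI[of _ "[h]"]) (auto simp: sym_closure_def)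
  next
    case (inv h)
    then show ?case using X by (intro exI[of _ "[inv h]"]) (auto simp: sym_closure_def)
  next
    case (eng h1 h2)
    then obtain w1 w2 where
      "set w1 \<subseteq> sym_closure G X" "foldr (\<otimes>) w1 \<one> = h1"
      "set w2 \<subseteq> sym_closure G X" "foldr (\<otimes>) w2 \<one> = h2" by blast
    then show ?case
      using foldr_mult_append[of w1 w2] sym_closure_carrier[OF X]
      by (intro exI[of _ "w1 @ w2"]) auto
  qed
qed

lemma word_length_witness:
  assumes "X \<in> generating_sets G" "g \<in> carrier G"
  obtains w where "length w = word_length G X g" "set w \<subseteq> sym_closure G X"
    "foldr (\<otimes>) w \<one> = g"
proof -
  obtain w where "set w \<subseteq> sym_closure G X" "foldr (\<otimes>) w \<one> = g"
    using word_exists[OF assms] by blast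
  then have "\<exists>v. length v = length w \<and> set v \<subseteq> sym_closure G X \<and> foldr (\<otimes>) v \<one> = g"
    by blast
  then have "\<exists>v. length v = word_length G X g \<and> set v \<subseteq> sym_closure G X \<and> foldr (\<otimes>) v \<one> = g"
    unfolding word_length_def by (rule LeastI)
  then show ?thesis using that by blast
qed

lemma word_length_le:
  assumes "set w \<subseteq> sym_closure G X" "foldr (\<otimes>) w \<one> = g"
  shows "word_length G X g \<le> length w"
  unfolding word_length_def by (rule Least_le) (use assms in blast)

lemma word_length_one: "word_length G X \<one> = 0"
  using word_length_le[of "[]" X \<one>] by simp

lemma word_length_mult:
  assumes "X \<in> generating_sets G" "g \<in> carrier G" "h \<in> carrier G"
  shows "word_length G X (g \<otimes> h) \<le> word_length G X g + word_length G X h"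
proof -
  obtain u where u: "length u = word_length G X g" "set u \<subseteq> sym_closure G X"
    "foldr (\<otimes>) u \<one> = g" using word_length_witness[OF assms(1,2)] .
  obtain v where v: "length v = word_length G X h" "set v \<subseteq> sym_closure G X"
    "foldr (\<otimes>) v \<one> = h" using word_length_witness[OF assms(1,3)] .
  have "sym_closure G X \<subseteq> carrier G"
    using assms(1) by (intro sym_closure_carrier) (auto simp: generating_sets_def)
  then show ?thesis
    using word_length_le[of "u @ v" X "g \<otimes> h"] u v foldr_mult_append[of u v] by auto
qed

lemma sym_closure_inv:
  assumes "X \<subseteq> carrier G" "x \<in> sym_closure G X"
  shows "inv x \<in> sym_closure G X"
  using assms by (auto simp: sym_closure_def)

lemma word_length_inv:
  assumes "X \<in> generating_sets G" "g \<in> carrier G"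
  shows "word_length G X (inv g) = word_length G X g"
proof -
  have X: "X \<subseteq> carrier G" using assms by (auto simp: generating_sets_def)
  have le: "word_length G X (inv h) \<le> word_length G X h" if h: "h \<in> carrier G" for h
  proof -
    obtain u where u: "length u = word_length G X h" "set u \<subseteq> sym_closure G X"
      "foldr (\<otimes>) u \<one> = h" using word_length_witness[OF assms(1) h] .
    have "set (rev (map (\<lambda>x. inv x) u)) \<subseteq> sym_closure G X"
      using u(2) sym_closure_inv[OF X] by auto
    moreover have "foldr (\<otimes>) (rev (map (\<lambda>x. inv x) u)) \<one> = inv h"
      using foldr_mult_inv[of u] u sym_closure_carrier[OF X] by auto
    ultimately show ?thesis using word_length_le u(1) by fastforce
  qed
  show ?thesis using le[OF assms(2)] le[of "inv g"] assms(2) by simp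
qed

lemma gen_le_refl: "gen_le G X X" if "X \<in> generating_sets G"
proof -
  have "word_length G X x \<le> 1" if "x \<in> X" for x
    using word_length_le[of "[x]" X x] that \<open>X \<in> generating_sets G\<close>
    by (auto simp: sym_closure_def generating_sets_def)
  then show ?thesis unfolding gen_le_def by (rule bdd_aboveI2)
qed

lemma gen_le_trans:
  assumes X: "X \<in> generating_sets G" and Y: "Y \<in> generating_sets G"
    and Z: "Z \<in> generating_sets G"
    and XY: "gen_le G X Y" and YZ: "gen_le G Y Z"
  shows "gen_le G X Z"
proof -
  obtain K where K: "\<And>y. y \<in> Y \<Longrightarrow> word_length G X y \<le> K"
    using XY by (auto simp: gen_le_def bdd_above_def)
  obtain L where L: "\<And>z. z \<in> Z \<Longrightarrow> word_length G Y z \<le> L"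
    using YZ by (auto simp: gen_le_def bdd_above_def)
  have Yc: "Y \<subseteq> carrier G" using Y by (auto simp: generating_sets_def)
  have K': "word_length G X y \<le> K" if "y \<in> sym_closure G Y" for y
    using that K word_length_inv[OF X] Yc by (auto simp: sym_closure_def)
  have word: "word_length G X (foldr (\<otimes>) w \<one>) \<le> length w * K"
    if "set w \<subseteq> sym_closure G Y" for w
    using that
  proof (induction w)
    case Nil
    then show ?case by (simp add: word_length_one)
  next
    case (Cons y w)
    then have "y \<in> carrier G" "foldr (\<otimes>) w \<one> \<in> carrier G"
      using sym_closure_carrier[OF Yc] foldr_mult_closed[of w] by auto
    then have "word_length G X (y \<otimes> foldr (\<otimes>) w \<one>)
        \<le> word_length G X y + word_length G X (foldr (\<otimes>) w \<one>)"
      by (rule word_length_mult[OF X])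
    also have "\<dots> \<le> K + length w * K" using Cons K' by (intro add_mono) auto
    finally show ?case by simp
  qed
  have "word_length G X z \<le> L * K" if z: "z \<in> Z" for z
  proof -
    have "z \<in> carrier G" using z Z by (auto simp: generating_sets_def)
    then obtain w where w: "length w = word_length G Y z" "set w \<subseteq> sym_closure G Y"
      "foldr (\<otimes>) w \<one> = z" using word_length_witness[OF Y] by blast
    then have "word_length G X z \<le> word_length G Y z * K" using word[OF w(2)] by simp
    also have "\<dots> \<le> L * K" using L[OF z] by simp
    finally show ?thesis .
  qed
  then show ?thesis unfolding gen_le_def by (rule bdd_aboveI2)
qed

lemma equiv_gen_equiv: "equiv (generating_sets G) (gen_equiv G)"
proof (rule equivI)
  show "trans (gen_equiv G)"
    unfolding trans_def gen_equiv_def using gen_le_trans by blast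
qed (auto simp: gen_equiv_def refl_on_def sym_def gen_le_refl)

lemma structure_le_gen_class:
  assumes "X \<in> generating_sets G" "Y \<in> generating_sets G"
  shows "structure_le G (gen_class G X) (gen_class G Y) \<longleftrightarrow> gen_le G X Y"
proof
  assume "structure_le G (gen_class G X) (gen_class G Y)"
  then obtain X' Y' where "(X, X') \<in> gen_equiv G" "(Y, Y') \<in> gen_equiv G" "gen_le G X' Y'"
    by (auto simp: structure_le_def gen_class_def)
  then show "gen_le G X Y"
    unfolding gen_equiv_def using gen_le_trans by blast
next
  assume "gen_le G X Y"
  then show "structure_le G (gen_class G X) (gen_class G Y)"
    using assms gen_le_refl by (auto simp: structure_le_def gen_class_def gen_equiv_def)
qed

lemma gen_class_eq_iff:
  assumes "X \<in> generating_sets G" "Y \<in> generating_sets G"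
  shows "gen_class G X = gen_class G Y \<longleftrightarrow> gen_le G X Y \<and> gen_le G Y X"
proof -
  have "gen_class G X = gen_class G Y \<longleftrightarrow> (X, Y) \<in> gen_equiv G"
    unfolding gen_class_def by (rule eq_equiv_class_iff[OF equiv_gen_equiv assms])
  then show ?thesis using assms by (simp add: gen_equiv_def)
qed

lemma quasi_parabolic_structures_subset:
  "quasi_parabolic_structures G \<subseteq> hyperbolic_structures G"
  by (auto simp: quasi_parabolic_structures_def hyperbolic_structures_def
      quasi_parabolic_generating_set_def)

lemma quasi_parabolic_structures_poset:
  shows "A \<in> quasi_parabolic_structures G \<Longrightarrow> structure_le G A A"
    and "\<lbrakk>A \<in> quasi_parabolic_structures G; B \<in> quasi_parabolic_structures G;
          structure_le G A B; structure_le G B A\<rbrakk> \<Longrightarrow> A = B"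
    and "\<lbrakk>A \<in> quasi_parabolic_structures G; B \<in> quasi_parabolic_structures G;
          C \<in> quasi_parabolic_structures G; structure_le G A B; structure_le G B C\<rbrakk>
        \<Longrightarrow> structure_le G A C"
proof -
  have rep: "\<exists>X\<in>generating_sets G. A = gen_class G X"
    if "A \<in> quasi_parabolic_structures G" for A
    using that by (auto simp: quasi_parabolic_structures_def
        quasi_parabolic_generating_set_def hyperbolic_generating_set_def)
  show "structure_le G A A" if "A \<in> quasi_parabolic_structures G"
    using rep[OF that] structure_le_gen_class gen_le_refl by auto
  show "A = B" if "A \<in> quasi_parabolic_structures G" "B \<in> quasi_parabolic_structures G"
    "structure_le G A B" "structure_le G B A"
    using rep[OF that(1)] rep[OF that(2)] that(3,4) structure_le_gen_class gen_class_eq_iff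
    by metis
  show "structure_le G A C"
    if "A \<in> quasi_parabolic_structures G" "B \<in> quasi_parabolic_structures G"
      "C \<in> quasi_parabolic_structures G" "structure_le G A B" "structure_le G B C"
    using rep[OF that(1)] rep[OF that(2)] rep[OF that(3)] that(4,5)
      structure_le_gen_class gen_le_trans by blast
qed

lemma group_action_left_translation: "group_action G (carrier G) (left_translation G)"
proof -
  have bij: "left_translation G g \<in> Bij (carrier G)" if g: "g \<in> carrier G" for g
  proof -
    have "bij_betw (left_translation G g) (carrier G) (carrier G)"
      by (rule bij_betwI[where g = "left_translation G (inv g)"])
        (use g in \<open>auto simp: left_translation_def m_assoc[symmetric]\<close>)
    then show ?thesis by (simp add: Bij_def left_translation_def)
  qed
  have "left_translation G \<in> hom G (BijGroup (carrier G))"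
    using bij by (auto simp: hom_def BijGroup_def left_translation_def compose_def m_assoc
        intro!: restrict_ext)
  then show ?thesis
    by (simp add: group_action_def group_hom_def group_hom_axioms_def group_BijGroup is_group)
qed

end

end

theory Submission
  imports Defs "HOL-Analysis.Continuum_Not_Denumerable"
begin

text \<open>For a subgroup \<open>H\<close> of \<open>G\<close> consider the lamp configurations with values in \<open>H\<close> at all negative
  positions. Together with the shift \<open>t\<close> they generate \<open>G wr \<int>\<close>, and conjugation by \<open>t\<close> maps this
  subgroup into itself, so that \<open>G wr \<int>\<close> is an ascending HNN extension of it. The Cayley graph is
  therefore within bounded distance of the Bass-Serre tree, and the whole group fixes the end
  represented by the powers of \<open>t\<inverse>\<close>. If \<open>H \<noteq> G\<close>, the tree branches, so it has infinitely many ends.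
  Elements of word length at most \<open>n\<close> in the base group take values in \<open>H\<close> at all positions below
  \<open>- n\<close>; hence the structures of \<open>H\<close> and \<open>K\<close> are ordered by reverse inclusion of \<open>H\<close> and \<open>K\<close>. It
  remains to embed \<open>P(\<nat>)\<close> with reversed order into the proper subgroups of the free group, for
  which the stabilisers of sets of points in a suitable permutation action serve.\<close>

section \<open>Cayley graphs and fixed boundary points\<close>

context group
begin

lemma inv_mult_mult_inv_mult:
  assumes "g \<in> carrier G" "h \<in> carrier G" "k \<in> carrier G"
  shows "(inv g \<otimes> h) \<otimes> (inv h \<otimes> k) = inv g \<otimes> k"
proof -
  have "h \<otimes> (inv h \<otimes> k) = k" using assms by (simp flip: m_assoc)
  then show ?thesis using assms by (simp add: m_assoc)
qed

lemma relpow_cayley_edges_iff: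
  assumes "X \<subseteq> carrier G" "g \<in> carrier G"
  shows "(g, h) \<in> cayley_edges G X ^^ n \<longleftrightarrow>
    (\<exists>w. length w = n \<and> set w \<subseteq> sym_closure G X \<and> h = g \<otimes> foldr (\<otimes>) w \<one>)"
  using assms(2)
proof (induction n arbitrary: g)
  case 0
  then show ?case by auto
next
  case (Suc n)
  have sc: "sym_closure G X \<subseteq> carrier G" by (rule sym_closure_carrier[OF assms(1)])
  \<comment> \<open>Commuting the powers peels off the first edge instead of the last, so that its
    label becomes the head of the word.\<close>
  have "(g, h) \<in> cayley_edges G X ^^ Suc n \<longleftrightarrow>
      (\<exists>s\<in>sym_closure G X. (g \<otimes> s, h) \<in> cayley_edges G X ^^ n)"
    using Suc.prems unfolding relpow.simps relpow_commute[symmetric] cayley_edges_def by blast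
  also have "\<dots> \<longleftrightarrow> (\<exists>s\<in>sym_closure G X. \<exists>w. length w = n \<and> set w \<subseteq> sym_closure G X \<and>
      h = g \<otimes> s \<otimes> foldr (\<otimes>) w \<one>)"
    using Suc.IH Suc.prems sc by (intro bex_cong) auto
  also have "\<dots> \<longleftrightarrow> (\<exists>s\<in>sym_closure G X. \<exists>w. length w = n \<and> set w \<subseteq> sym_closure G X \<and>
      h = g \<otimes> (s \<otimes> foldr (\<otimes>) w \<one>))"
  proof (intro bex_cong refl ex_cong1 conj_cong)
    fix s w assume "s \<in> sym_closure G X" "set w \<subseteq> sym_closure G X"
    then have "s \<in> carrier G" "foldr (\<otimes>) w \<one> \<in> carrier G"
      using sc foldr_mult_closed by blast+
    then show "(h = g \<otimes> s \<otimes> foldr (\<otimes>) w \<one>) = (h = g \<otimes> (s \<otimes> foldr (\<otimes>) w \<one>))"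
      using Suc.prems by (simp add: m_assoc)
  qed
  also have "\<dots> \<longleftrightarrow> (\<exists>w. length w = Suc n \<and> set w \<subseteq> sym_closure G X \<and>
      h = g \<otimes> foldr (\<otimes>) w \<one>)"
  proof
      assume "\<exists>s\<in>sym_closure G X. \<exists>w. length w = n \<and> set w \<subseteq> sym_closure G X \<and>
        h = g \<otimes> (s \<otimes> foldr (\<otimes>) w \<one>)"
      then obtain s w where "s \<in> sym_closure G X" "length w = n" "set w \<subseteq> sym_closure G X"
        "h = g \<otimes> (s \<otimes> foldr (\<otimes>) w \<one>)" by blast
      then show "\<exists>w. length w = Suc n \<and> set w \<subseteq> sym_closure G X \<and> h = g \<otimes> foldr (\<otimes>) w \<one>"
        by (intro exI[of _ "s # w"]) simp
  qed (fastforce simp: length_Suc_conv)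
  finally show ?case .
qed

lemma cayley_dist_eq_word_length:
  assumes "X \<subseteq> carrier G" "g \<in> carrier G" "h \<in> carrier G"
  shows "cayley_dist G X g h = real (word_length G X (inv g \<otimes> h))"
proof -
  have "h = g \<otimes> foldr (\<otimes>) w \<one> \<longleftrightarrow> foldr (\<otimes>) w \<one> = inv g \<otimes> h"
    if "set w \<subseteq> sym_closure G X" for w
  proof -
    have "foldr (\<otimes>) w \<one> \<in> carrier G"
      using that sym_closure_carrier[OF assms(1)] by (intro foldr_mult_closed) auto
    then show ?thesis using assms by (simp add: inv_solve_left)
  qed
  then have "(\<lambda>n. (g, h) \<in> cayley_edges G X ^^ n) =
      (\<lambda>n. \<exists>w. length w = n \<and> set w \<subseteq> sym_closure G X \<and> foldr (\<otimes>) w \<one> = inv g \<otimes> h)"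
    unfolding relpow_cayley_edges_iff[OF assms(1,2)] by blast
  then show ?thesis by (simp add: cayley_dist_def word_length_def)
qed

text \<open>Reduces generation to connectedness: a set generates once edge paths from the identity
  reach every element.\<close>

lemma cayley_edges_rtrancl_generate:
  assumes "(g, h) \<in> (cayley_edges G X)\<^sup>*" "g \<in> generate G X" "X \<subseteq> carrier G"
  shows "h \<in> generate G X"
  using assms(1,2)
proof induction
  case (step h k)
  then obtain s where s: "s \<in> sym_closure G X" "k = h \<otimes> s" by (auto simp: cayley_edges_def)
  then have "s \<in> generate G X" by (auto simp: sym_closure_def intro: generate.intros)
  then show ?case using s step by (auto intro: generate.eng)
qed

context
  fixes X assumes X: "X \<in> generating_sets G"
begin

lemma generating_subset: "X \<subseteq> carrier G"
  using X by (simp add: generating_sets_def)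

lemma cayley_dist_translate:
  assumes "a \<in> carrier G" "g \<in> carrier G" "h \<in> carrier G"
  shows "cayley_dist G X (a \<otimes> g) (a \<otimes> h) = cayley_dist G X g h"
proof -
  have "inv (a \<otimes> g) \<otimes> (a \<otimes> h) = inv g \<otimes> (inv a \<otimes> (a \<otimes> h))"
    using assms by (simp add: inv_mult_group m_assoc)
  also have "\<dots> = inv g \<otimes> h" using assms by (simp add: m_assoc[symmetric])
  finally show ?thesis
    using assms by (simp add: cayley_dist_eq_word_length[OF generating_subset])
qed

lemma cayley_dist_sym:
  assumes "g \<in> carrier G" "h \<in> carrier G"
  shows "cayley_dist G X g h = cayley_dist G X h g"
  using assms word_length_inv[OF X, of "inv g \<otimes> h"]
  by (simp add: cayley_dist_eq_word_length[OF generating_subset] inv_mult_group)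

lemma cayley_dist_triangle:
  assumes "g \<in> carrier G" "h \<in> carrier G" "k \<in> carrier G"
  shows "cayley_dist G X g k \<le> cayley_dist G X g h + cayley_dist G X h k"
  using assms word_length_mult[OF X, of "inv g \<otimes> h" "inv h \<otimes> k"]
  by (simp add: cayley_dist_eq_word_length[OF generating_subset] inv_mult_mult_inv_mult)

lemma cayley_dist_self: "g \<in> carrier G \<Longrightarrow> cayley_dist G X g g = 0"
  by (simp add: cayley_dist_eq_word_length[OF generating_subset] word_length_one)

text \<open>Translation carries the base point to \<open>a\<close>; moving it back to the identity
  costs at most the distance between the two.\<close>

lemma gromov_product_translate:
  assumes "a \<in> carrier G" "g \<in> carrier G" "h \<in> carrier G"
  shows "gromov_product (cayley_dist G X) \<one> (a \<otimes> g) (a \<otimes> h)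
    \<ge> gromov_product (cayley_dist G X) \<one> g h - cayley_dist G X \<one> a"
proof -
  let ?d = "cayley_dist G X"
  have eqs: "?d a (a \<otimes> g) = ?d \<one> g" "?d a (a \<otimes> h) = ?d \<one> h"
    "?d (a \<otimes> g) (a \<otimes> h) = ?d g h" "?d a \<one> = ?d \<one> a"
    using assms cayley_dist_translate[of a \<one>] cayley_dist_translate[of a g h]
      cayley_dist_sym[of a \<one>] by simp_all
  have "?d a (a \<otimes> g) \<le> ?d a \<one> + ?d \<one> (a \<otimes> g)" "?d a (a \<otimes> h) \<le> ?d a \<one> + ?d \<one> (a \<otimes> h)"
    using assms by (simp_all add: cayley_dist_triangle)
  then show ?thesis unfolding gromov_product_def using eqs by (simp add: field_simps)
qed

lemma gromov_sequences_translate: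
  assumes "a \<in> carrier G" "y \<in> gromov_sequences (carrier G) (cayley_dist G X) \<one>"
  shows "left_translation G a \<circ> y \<in> gromov_sequences (carrier G) (cayley_dist G X) \<one>"
proof -
  let ?gp = "gromov_product (cayley_dist G X) \<one>"
  have y: "y i \<in> carrier G" for i using assms(2) by (auto simp: gromov_sequences_def)
  have "\<exists>N. \<forall>i\<ge>N. \<forall>j\<ge>N. ?gp (a \<otimes> y i) (a \<otimes> y j) \<ge> K" for K
  proof -
    have "\<exists>N. \<forall>i\<ge>N. \<forall>j\<ge>N. ?gp (y i) (y j) \<ge> K + cayley_dist G X \<one> a"
      using assms(2) by (simp add: gromov_sequences_def)
    then obtain N where "\<And>i j. i \<ge> N \<Longrightarrow> j \<ge> N \<Longrightarrow> ?gp (y i) (y j) \<ge> K + cayley_dist G X \<one> a"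
      by blast
    then have "?gp (a \<otimes> y i) (a \<otimes> y j) \<ge> K" if "i \<ge> N" "j \<ge> N" for i j
      using gromov_product_translate[OF assms(1) y y, of i j] that by fastforce
    then show ?thesis by blast
  qed
  then show ?thesis
    using assms(1) y by (auto simp: gromov_sequences_def left_translation_def)
qed

text \<open>By \<open>near\<close>, an element \<open>a\<close> displaces the tail of
  \<open>x\<close> by a bounded amount, so \<open>x i\<close> and \<open>a \<otimes> x i\<close>
  have large Gromov product; hyperbolicity then links \<open>x i\<close>,
  \<open>a \<otimes> x i\<close> and \<open>a \<otimes> y j\<close>.\<close>

lemma boundary_point_fixed:
  assumes hyp: "gromov_hyperbolic (carrier G) (cayley_dist G X)"
    and x: "x \<in> gromov_sequences (carrier G) (cayley_dist G X) \<one>"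
    and near: "\<And>a. a \<in> carrier G \<Longrightarrow> \<exists>C J. \<forall>j\<ge>J. cayley_dist G X (a \<otimes> x j) (x j) \<le> C"
    and a: "a \<in> carrier G"
  shows "boundary_map (left_translation G a) (gromov_rel (carrier G) (cayley_dist G X) \<one> `` {x})
    = gromov_rel (carrier G) (cayley_dist G X) \<one> `` {x}"
proof -
  let ?d = "cayley_dist G X" and ?gp = "gromov_product (cayley_dist G X) \<one>"
  let ?\<xi> = "gromov_rel (carrier G) ?d \<one> `` {x}"
  have xc: "x i \<in> carrier G" for i using x by (auto simp: gromov_sequences_def)
  have xx: "\<exists>N. \<forall>i\<ge>N. \<forall>j\<ge>N. ?gp (x i) (x j) \<ge> K" for K
    using x by (simp add: gromov_sequences_def)
  obtain \<delta> where \<delta>: "\<And>u v w. u \<in> carrier G \<Longrightarrow> v \<in> carrier G \<Longrightarrow> w \<in> carrier G \<Longrightarrow>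
      ?gp u w \<ge> min (?gp u v) (?gp v w) - \<delta>"
    using hyp unfolding gromov_hyperbolic_def by (meson one_closed)
  have closed: "left_translation G b \<circ> y \<in> ?\<xi>" if b: "b \<in> carrier G" and y: "y \<in> ?\<xi>" for b y
  proof -
    have ys: "y \<in> gromov_sequences (carrier G) ?d \<one>"
      and xy: "\<And>K. \<exists>N. \<forall>i\<ge>N. \<forall>j\<ge>N. ?gp (x i) (y j) \<ge> K"
      using y by (simp_all add: gromov_rel_def)
    have yc: "y i \<in> carrier G" for i using ys by (auto simp: gromov_sequences_def)
    obtain C J where C: "\<And>j. j \<ge> J \<Longrightarrow> ?d (b \<otimes> x j) (x j) \<le> C" using near[OF b] by blast
    have "\<exists>N. \<forall>i\<ge>N. \<forall>j\<ge>N. ?gp (x i) (b \<otimes> y j) \<ge> K" for K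
    proof -
      define K' where "K' = K + \<delta>"
      obtain N1 where N1: "\<And>i j. i \<ge> N1 \<Longrightarrow> j \<ge> N1 \<Longrightarrow> ?gp (x i) (y j) \<ge> K' + ?d \<one> b"
        using xy[of "K' + ?d \<one> b"] by blast
      obtain N2 where N2: "\<And>i j. i \<ge> N2 \<Longrightarrow> j \<ge> N2 \<Longrightarrow> ?gp (x i) (x j) \<ge> K' + C"
        using xx[of "K' + C"] by blast
      have "?gp (x i) (b \<otimes> y j) \<ge> K" if "i \<ge> N1 + N2 + J" "j \<ge> N1 + N2 + J" for i j
      proof -
        have "?gp (b \<otimes> x i) (b \<otimes> y j) \<ge> K'"
          using gromov_product_translate[OF b xc yc, of i j] N1[of i j] that by simp
        moreover have "?gp (x i) (b \<otimes> x i) \<ge> K'"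
        proof -
          \<comment> \<open>The diagonal case of \<open>N2\<close> bounds a distance: the Gromov
            product of a point with itself is its distance from the base point.\<close>
          have "?d \<one> (x i) \<ge> K' + C"
            using N2[of i i] that xc[of i] by (simp add: gromov_product_def cayley_dist_self)
          moreover have "?d (b \<otimes> x i) (x i) \<le> C" using C that by simp
          moreover have "?d \<one> (x i) \<le> ?d \<one> (b \<otimes> x i) + ?d (b \<otimes> x i) (x i)"
            using b xc by (intro cayley_dist_triangle) auto
          moreover have "?d (x i) (b \<otimes> x i) = ?d (b \<otimes> x i) (x i)"
            using b xc by (intro cayley_dist_sym) auto
          ultimately show ?thesis by (simp add: gromov_product_def field_simps)
        qed
        ultimately show ?thesis
          using \<delta>[of "x i" "b \<otimes> x i" "b \<otimes> y j"] b xc yc by (simp add: K'_def min_def split: if_splits)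
      qed
      then show ?thesis by blast
    qed
    then show ?thesis
      using gromov_sequences_translate[OF b ys] x yc
      by (auto simp: gromov_rel_def left_translation_def)
  qed
  \<comment> \<open>The reverse inclusion comes from \<open>closed\<close> applied to
    \<open>inv a\<close>.\<close>
  have "y \<in> boundary_map (left_translation G a) ?\<xi>" if y: "y \<in> ?\<xi>" for y
  proof -
    have yc: "y i \<in> carrier G" for i
      using y by (auto simp: gromov_rel_def gromov_sequences_def)
    have "y = left_translation G a \<circ> (left_translation G (inv a) \<circ> y)"
      using a yc by (auto simp: left_translation_def fun_eq_iff m_assoc[symmetric])
    then show ?thesis unfolding boundary_map_def using closed[of "inv a"] a y by auto
  qed
  then show ?thesis unfolding boundary_map_def using closed a by auto
qed

end

end


section \<open>Trees for wreath products with the integers\<close>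

text \<open>The carrier of \<open>integer_group\<close> is all of \<open>int\<close>, so the
  extensional functions of the wreath product are plain functions here.\<close>

definition lamps :: "('a, 'm) monoid_scheme \<Rightarrow> (int \<Rightarrow> 'a) set"
  where "lamps G = {f. range f \<subseteq> carrier G \<and> finite {x. f x \<noteq> \<one>\<^bsub>G\<^esub>}}"

text \<open>The whole base subgroup of the HNN extension is taken as generators, next to the stable
  letter; if \<open>H\<close> is a subgroup, every left coset of the base then has diameter at most
  1.\<close>

definition horo_gens :: "('a, 'm) monoid_scheme \<Rightarrow> 'a set \<Rightarrow> ((int \<Rightarrow> 'a) \<times> int) set"
  where "horo_gens G H =
    insert (\<lambda>_. \<one>\<^bsub>G\<^esub>, 1) {(f, 0) | f. f \<in> lamps G \<and> (\<forall>x<0. f x \<in> H)}"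

locale wreath_tree = group G + subgroup H G for G (structure) and H
begin

abbreviation "\<Gamma> \<equiv> restricted_wreath G integer_group"

abbreviation "X \<equiv> horo_gens G H"

sublocale W: group \<Gamma>
  by (intro group_restricted_wreath is_group group_integer_group)

lemma carrier_wreath: "carrier \<Gamma> = lamps G \<times> UNIV"
  by (auto simp: restricted_wreath_def lamps_def)

lemma mult_wreath: "(f, i) \<otimes>\<^bsub>\<Gamma>\<^esub> (f', j) = (\<lambda>x. f x \<otimes> f' (x - i), i + j)"
  by (auto simp: restricted_wreath_def fun_eq_iff)

lemma one_wreath: "\<one>\<^bsub>\<Gamma>\<^esub> = (\<lambda>_. \<one>, 0)"
  by (auto simp: restricted_wreath_def fun_eq_iff)

lemma lamp_closed [simp]: "f \<in> lamps G \<Longrightarrow> f x \<in> carrier G"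
  by (auto simp: lamps_def)

lemma lamps_one [simp]: "(\<lambda>_. \<one>) \<in> lamps G"
  by (auto simp: lamps_def)

lemma lamps_single [simp]: "c \<in> carrier G \<Longrightarrow> (\<lambda>x. if x = m then c else \<one>) \<in> lamps G"
  by (auto simp: lamps_def)

lemma lamps_comp_diff:
  assumes "f \<in> lamps G" "f' \<in> lamps G"
  shows "(\<lambda>x. inv (f (x + k)) \<otimes> f' (x + k)) \<in> lamps G"
proof -
  have "{x. inv (f (x + k)) \<otimes> f' (x + k) \<noteq> \<one>} \<subseteq>
      (\<lambda>x. x - k) ` ({x. f x \<noteq> \<one>} \<union> {x. f' x \<noteq> \<one>})"
  proof
    fix x assume "x \<in> {x. inv (f (x + k)) \<otimes> f' (x + k) \<noteq> \<one>}"
    then have "x + k \<in> {x. f x \<noteq> \<one>} \<union> {x. f' x \<noteq> \<one>}" by auto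
    then show "x \<in> (\<lambda>x. x - k) ` ({x. f x \<noteq> \<one>} \<union> {x. f' x \<noteq> \<one>})"
      by (intro image_eqI[of _ _ "x + k"]) auto
  qed
  moreover have "finite ((\<lambda>x. x - k) ` ({x. f x \<noteq> \<one>} \<union> {x. f' x \<noteq> \<one>}))"
    using assms by (auto simp: lamps_def)
  ultimately have "finite {x. inv (f (x + k)) \<otimes> f' (x + k) \<noteq> \<one>}" by (rule finite_subset)
  then show ?thesis using assms by (auto simp: lamps_def)
qed

text \<open>Equality of left cosets of \<open>H\<close> at all positions below \<open>k\<close>. For
  lamp configurations, \<open>agree i f f'\<close> says that \<open>(f, i)\<close> and
  \<open>(f', i)\<close> lie in the same left coset of the base subgroup.\<close>

definition agree :: "int \<Rightarrow> (int \<Rightarrow> 'a) \<Rightarrow> (int \<Rightarrow> 'a) \<Rightarrow> bool"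
  where "agree k f f' \<longleftrightarrow> (\<forall>x<k. inv (f x) \<otimes> f' x \<in> H)"

lemma agree_refl: "f \<in> lamps G \<Longrightarrow> agree k f f"
  by (auto simp: agree_def)

lemma agree_sym:
  assumes "f \<in> lamps G" "f' \<in> lamps G" "agree k f f'"
  shows "agree k f' f"
  unfolding agree_def
proof (intro allI impI)
  fix x assume "x < k"
  then have "inv (inv (f x) \<otimes> f' x) \<in> H" using assms by (auto simp: agree_def)
  then show "inv (f' x) \<otimes> f x \<in> H" using assms by (simp add: inv_mult_group)
qed

lemma agree_trans:
  assumes "f \<in> lamps G" "f' \<in> lamps G" "f'' \<in> lamps G" "agree k f f'" "agree k f' f''"
  shows "agree k f f''"
  unfolding agree_def
proof (intro allI impI)
  fix x assume "x < k"
  then have "(inv (f x) \<otimes> f' x) \<otimes> (inv (f' x) \<otimes> f'' x) \<in> H" using assms by (auto simp: agree_def)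
  then show "inv (f x) \<otimes> f'' x \<in> H" using assms by (simp add: inv_mult_mult_inv_mult)
qed

lemma agree_mono: "agree k f f' \<Longrightarrow> l \<le> k \<Longrightarrow> agree l f f'"
  by (auto simp: agree_def)

text \<open>Both supports are finite, so far enough down both configurations are trivial. This makes
  the \<open>LEAST\<close> in the merging height meaningful.\<close>

lemma agree_exists:
  assumes "f \<in> lamps G" "f' \<in> lamps G"
  shows "\<exists>n::nat. agree (k - int n) f f'"
proof -
  have "finite ({x. f x \<noteq> \<one>} \<union> {x. f' x \<noteq> \<one>})" using assms by (auto simp: lamps_def)
  then have "bdd_below ({x. f x \<noteq> \<one>} \<union> {x. f' x \<noteq> \<one>})" by (rule bdd_below_finite)
  then obtain b where b: "\<forall>x\<in>{x. f x \<noteq> \<one>} \<union> {x. f' x \<noteq> \<one>}. b \<le> x"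
    unfolding bdd_below_def ..
  have "agree b f f'"
    unfolding agree_def
  proof (intro allI impI)
    fix x assume "x < b"
    then have "f x = \<one>" "f' x = \<one>" using b by force+
    then show "inv (f x) \<otimes> f' x \<in> H" by simp
  qed
  then have "agree (k - int (nat (k - b))) f f'" by (rule agree_mono) auto
  then show ?thesis by blast
qed

text \<open>The vertices \<open>(f, i)\<close>, modulo agreement below \<open>i\<close>, form a tree in which the parent
  of \<open>(f, i)\<close> is \<open>(f, i - 1)\<close>; the height at which two branches merge is the following.\<close>

definition merge :: "(int \<Rightarrow> 'a) \<times> int \<Rightarrow> (int \<Rightarrow> 'a) \<times> int \<Rightarrow> int"
  where "merge p q = min (snd p) (snd q) -
    int (LEAST n. agree (min (snd p) (snd q) - int n) (fst p) (fst q))"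

lemma merge_le: "merge p q \<le> snd p" "merge p q \<le> snd q"
  by (auto simp: merge_def)

lemma agree_merge:
  assumes "p \<in> carrier \<Gamma>" "q \<in> carrier \<Gamma>"
  shows "agree (merge p q) (fst p) (fst q)"
  unfolding merge_def by (rule LeastI_ex, rule agree_exists) (use assms in \<open>auto simp: carrier_wreath\<close>)

text \<open>With \<open>merge_le\<close> and \<open>agree_merge\<close> this characterises
  \<open>merge\<close> as a greatest level; later arguments rest on these three facts.\<close>

lemma le_mergeI:
  assumes "agree k (fst p) (fst q)" "k \<le> snd p" "k \<le> snd q"
  shows "k \<le> merge p q"
proof -
  let ?m = "min (snd p) (snd q)"
  have "(LEAST n. agree (?m - int n) (fst p) (fst q)) \<le> nat (?m - k)"
    by (rule Least_le) (use assms in auto)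
  then show ?thesis unfolding merge_def using assms by linarith
qed

lemma merge_sym:
  assumes "p \<in> carrier \<Gamma>" "q \<in> carrier \<Gamma>"
  shows "merge p q = merge q p"
proof -
  have "merge p q \<le> merge q p" if "p \<in> carrier \<Gamma>" "q \<in> carrier \<Gamma>" for p q
  proof (rule le_mergeI)
    show "agree (merge p q) (fst q) (fst p)"
      by (rule agree_sym) (use that agree_merge[of p q] in \<open>auto simp: carrier_wreath\<close>)
  qed (rule merge_le)+
  then show ?thesis using assms by (simp add: antisym)
qed

text \<open>Agreement below a common level is transitive. This ultrametric inequality is the source
  of all tree geometry below.\<close>

lemma merge_ultra:
  assumes "p \<in> carrier \<Gamma>" "q \<in> carrier \<Gamma>" "r \<in> carrier \<Gamma>"
  shows "min (merge p q) (merge q r) \<le> merge p r"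
proof (rule le_mergeI)
  show "agree (min (merge p q) (merge q r)) (fst p) (fst r)"
    by (rule agree_trans[of _ "fst q"])
      (use assms agree_merge[of p q] agree_merge[of q r] in
        \<open>auto simp: carrier_wreath intro: agree_mono\<close>)
qed (use merge_le[of p q] merge_le[of q r] in auto)

text \<open>Length of the path that descends from \<open>p\<close> to the merging level and climbs
  to \<open>q\<close>.\<close>

definition tree_dist :: "(int \<Rightarrow> 'a) \<times> int \<Rightarrow> (int \<Rightarrow> 'a) \<times> int \<Rightarrow> int"
  where "tree_dist p q = snd p + snd q - 2 * merge p q"

lemma tree_dist_nonneg: "tree_dist p q \<ge> 0"
  using merge_le[of p q] by (simp add: tree_dist_def)

lemma tree_dist_triangle:
  assumes "p \<in> carrier \<Gamma>" "q \<in> carrier \<Gamma>" "r \<in> carrier \<Gamma>"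
  shows "tree_dist p r \<le> tree_dist p q + tree_dist q r"
  using merge_ultra[OF assms] merge_le[of p q] merge_le[of q r]
  by (auto simp: tree_dist_def)

section \<open>Comparison of the Cayley graph with the tree\<close>

lemma horo_gens_carrier: "X \<subseteq> carrier \<Gamma>"
  by (auto simp: horo_gens_def carrier_wreath)

lemma inv_lamp:
  assumes "q \<in> lamps G"
  shows "(\<lambda>x. inv (q x)) \<in> lamps G" "inv\<^bsub>\<Gamma>\<^esub> (q, 0) = (\<lambda>x. inv (q x), 0)"
proof -
  show l: "(\<lambda>x. inv (q x)) \<in> lamps G"
    using lamps_comp_diff[OF assms lamps_one, of 0] assms by simp
  show "inv\<^bsub>\<Gamma>\<^esub> (q, 0) = (\<lambda>x. inv (q x), 0)"
    by (rule W.inv_equality) (use assms l in \<open>auto simp: mult_wreath one_wreath carrier_wreath\<close>)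
qed

lemma inv_shift: "inv\<^bsub>\<Gamma>\<^esub> (\<lambda>_. \<one>, 1) = (\<lambda>_. \<one>, -1)"
  by (rule W.inv_equality) (auto simp: mult_wreath one_wreath carrier_wreath)

text \<open>The generators of height 0 are already closed under inverses because \<open>H\<close> is
  a subgroup; only the inverse shift is added.\<close>

lemma sym_closure_horo_gens:
  "sym_closure \<Gamma> X = {(\<lambda>_. \<one>, 1), (\<lambda>_. \<one>, -1)} \<union> {(q, 0) | q. q \<in> lamps G \<and> (\<forall>x<0. q x \<in> H)}"
  (is "?L = ?R")
proof
  show "?L \<subseteq> ?R"
    by (auto simp: sym_closure_def horo_gens_def inv_shift inv_lamp)
  show "?R \<subseteq> ?L"
    by (auto simp: sym_closure_def horo_gens_def inv_shift)
qed

lemma edge_up: "f \<in> lamps G \<Longrightarrow> ((f, i), (f, i + 1)) \<in> cayley_edges \<Gamma> X"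
  by (auto simp: cayley_edges_def sym_closure_horo_gens mult_wreath carrier_wreath
      intro!: exI[of _ "\<lambda>_. \<one>"] exI[of _ f] exI[of _ i] exI[of _ 1])

lemma edge_down: "f \<in> lamps G \<Longrightarrow> ((f, i), (f, i - 1)) \<in> cayley_edges \<Gamma> X"
  by (auto simp: cayley_edges_def sym_closure_horo_gens mult_wreath carrier_wreath
      intro!: exI[of _ "\<lambda>_. \<one>"] exI[of _ f] exI[of _ i] exI[of _ "-1"])

lemma edge_level:
  assumes "f \<in> lamps G" "f' \<in> lamps G" "agree i f f'"
  shows "((f, i), (f', i)) \<in> cayley_edges \<Gamma> X"
proof -
  \<comment> \<open>The quotient of the two configurations, moved by \<open>i\<close> so that the
    positions below \<open>i\<close> become the negative ones.\<close>
  let ?q = "\<lambda>x. inv (f (x + i)) \<otimes> f' (x + i)"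
  have "(?q, 0) \<in> sym_closure \<Gamma> X"
    using assms lamps_comp_diff by (auto simp: sym_closure_horo_gens agree_def)
  moreover have "f x \<otimes> (inv (f x) \<otimes> f' x) = f' x" for x
    using assms(1,2) by (simp add: m_assoc[symmetric])
  then have "(f', i) = (f, i) \<otimes>\<^bsub>\<Gamma>\<^esub> (?q, 0)"
    using assms by (simp add: mult_wreath)
  ultimately show ?thesis
    unfolding cayley_edges_def using assms(1) by (auto simp: carrier_wreath)
qed

lemma relpow_up: "f \<in> lamps G \<Longrightarrow> ((f, i), (f, i + int n)) \<in> cayley_edges \<Gamma> X ^^ n"
proof (induction n)
  case (Suc n)
  then show ?case using edge_up[of f "i + int n"] by (auto simp: add_ac intro!: relpow_Suc_I)
qed auto

lemma relpow_down: "f \<in> lamps G \<Longrightarrow> ((f, i), (f, i - int n)) \<in> cayley_edges \<Gamma> X ^^ n"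
proof (induction n)
  case (Suc n)
  then show ?case
    using edge_down[of f "i - int n"] by (auto simp: algebra_simps intro!: relpow_Suc_I)
qed auto

text \<open>Descend to the merging level, cross one level edge there, and climb; the crossing
  accounts for the \<open>+ 1\<close>.\<close>

lemma relpow_tree_dist:
  assumes "p \<in> carrier \<Gamma>" "q \<in> carrier \<Gamma>"
  shows "(p, q) \<in> cayley_edges \<Gamma> X ^^ nat (tree_dist p q + 1)"
proof -
  obtain f i f' j where pq: "p = (f, i)" "q = (f', j)" by fastforce
  have f: "f \<in> lamps G" "f' \<in> lamps G" using assms pq by (auto simp: carrier_wreath)
  let ?E = "cayley_edges \<Gamma> X" and ?k = "merge p q"
  define n m where "n = nat (i - ?k)" and "m = nat (j - ?k)"
  have nm: "int n = i - ?k" "int m = j - ?k" using merge_le[of p q] pq by (auto simp: n_def m_def)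
  have "((f, i), (f, ?k)) \<in> ?E ^^ n" using relpow_down[OF f(1), of i n] nm by simp
  moreover have "((f, ?k), (f', ?k)) \<in> ?E ^^ 1"
    using edge_level[OF f] agree_merge[OF assms] pq by simp
  moreover have "((f', ?k), (f', j)) \<in> ?E ^^ m" using relpow_up[OF f(2), of ?k m] nm by simp
  ultimately have "((f, i), (f', j)) \<in> ?E ^^ (n + 1 + m)"
    by (auto simp only: relpow_add intro!: relcompI)
  moreover have "n + 1 + m = nat (tree_dist p q + 1)" using nm pq by (simp add: tree_dist_def)
  ultimately show ?thesis using pq by (simp only:)
qed

text \<open>A shift moves to the parent or to a child in the tree, while a generator of height 0
  stays at the same tree vertex.\<close>

lemma tree_dist_edge:
  assumes "(p, q) \<in> cayley_edges \<Gamma> X"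
  shows "q \<in> carrier \<Gamma>" "tree_dist p q \<le> 1"
proof -
  obtain f i s where p: "p = (f, i)" "f \<in> lamps G" and s: "s \<in> sym_closure \<Gamma> X" "q = p \<otimes>\<^bsub>\<Gamma>\<^esub> s"
    using assms by (auto simp: cayley_edges_def carrier_wreath)
  have "s \<in> carrier \<Gamma>" using s W.sym_closure_carrier[OF horo_gens_carrier] by blast
  then show q: "q \<in> carrier \<Gamma>" using s p W.m_closed[of p s] by (simp add: carrier_wreath)
  consider "q = (f, i + 1)" | "q = (f, i - 1)" |
      r where "q = (\<lambda>x. f x \<otimes> r (x - i), i)" "r \<in> lamps G" "\<forall>x<0. r x \<in> H"
    using s p by (auto simp: sym_closure_horo_gens mult_wreath)
  then show "tree_dist p q \<le> 1"
  proof cases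
    case 1
    then have "i \<le> merge p q" using p by (intro le_mergeI) (auto simp: agree_refl)
    then show ?thesis using 1 p by (simp add: tree_dist_def)
  next
    case 2
    then have "i - 1 \<le> merge p q" using p by (intro le_mergeI) (auto simp: agree_refl)
    then show ?thesis using 2 p by (simp add: tree_dist_def)
  next
    case 3
    have "inv (f x) \<otimes> (f x \<otimes> r (x - i)) = r (x - i)" for x
      using p 3 by (simp add: m_assoc[symmetric])
    then have "i \<le> merge p q" using p 3 by (intro le_mergeI) (auto simp: agree_def)
    then show ?thesis using 3 p by (simp add: tree_dist_def)
  qed
qed

lemma tree_dist_relpow:
  assumes "(p, q) \<in> cayley_edges \<Gamma> X ^^ n" "p \<in> carrier \<Gamma>"
  shows "q \<in> carrier \<Gamma> \<and> tree_dist p q \<le> int n"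
  using assms(1)
proof (induction n arbitrary: q)
  case 0
  have "snd p \<le> merge p p"
    using assms(2) by (intro le_mergeI agree_refl) (auto simp: carrier_wreath)
  then show ?case using 0 assms(2) by (simp add: tree_dist_def)
next
  case (Suc n)
  then obtain r where r: "(p, r) \<in> cayley_edges \<Gamma> X ^^ n" "(r, q) \<in> cayley_edges \<Gamma> X"
    by auto
  then show ?case
    using Suc.IH[OF r(1)] tree_dist_edge[OF r(2)] tree_dist_triangle[of p r q] assms(2) by auto
qed

lemma cayley_dist_bounds:
  assumes "p \<in> carrier \<Gamma>" "q \<in> carrier \<Gamma>"
  shows "of_int (tree_dist p q) \<le> cayley_dist \<Gamma> X p q"
    and "cayley_dist \<Gamma> X p q \<le> of_int (tree_dist p q) + 1"
proof -
  let ?n = "LEAST n. (p, q) \<in> cayley_edges \<Gamma> X ^^ n"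
  have "(p, q) \<in> cayley_edges \<Gamma> X ^^ ?n" using relpow_tree_dist[OF assms] by (rule LeastI)
  then have "tree_dist p q \<le> int ?n" using tree_dist_relpow assms(1) by blast
  then show "of_int (tree_dist p q) \<le> cayley_dist \<Gamma> X p q" by (simp add: cayley_dist_def)
  have "?n \<le> nat (tree_dist p q + 1)" using relpow_tree_dist[OF assms] by (rule Least_le)
  then show "cayley_dist \<Gamma> X p q \<le> of_int (tree_dist p q) + 1"
    using tree_dist_nonneg[of p q] by (simp add: cayley_dist_def)
qed

lemma horo_gens_generating: "X \<in> generating_sets \<Gamma>"
proof -
  have "g \<in> generate \<Gamma> X" if "g \<in> carrier \<Gamma>" for g
    using relpow_imp_rtrancl[OF relpow_tree_dist[OF W.one_closed that]] horo_gens_carrier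
    by (rule W.cayley_edges_rtrancl_generate[OF _ generate.one])
  then show ?thesis
    using horo_gens_carrier W.generate_in_carrier[OF horo_gens_carrier]
    by (auto simp: generating_sets_def)
qed

section \<open>Hyperbolicity\<close>

definition tree_product :: "(int \<Rightarrow> 'a) \<times> int \<Rightarrow> (int \<Rightarrow> 'a) \<times> int \<Rightarrow> (int \<Rightarrow> 'a) \<times> int \<Rightarrow> int"
  where "tree_product p x y = snd p + merge x y - merge p x - merge p y"

text \<open>\<open>tree_product\<close> is the Gromov product of \<open>tree_dist\<close>. Each
  Cayley distance exceeds the tree distance by between 0 and 1; two of them enter with weight 1/2
  and one with weight -1/2.\<close>

lemma gromov_product_bounds:
  assumes "p \<in> carrier \<Gamma>" "x \<in> carrier \<Gamma>" "y \<in> carrier \<Gamma>"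
  shows "of_int (tree_product p x y) - 1/2 \<le> gromov_product (cayley_dist \<Gamma> X) p x y"
    and "gromov_product (cayley_dist \<Gamma> X) p x y \<le> of_int (tree_product p x y) + 1"
  using cayley_dist_bounds[OF assms(1,2)] cayley_dist_bounds[OF assms(1,3)]
    cayley_dist_bounds[OF assms(2,3)]
  by (auto simp: tree_product_def gromov_product_def tree_dist_def)

text \<open>Trees are 0-hyperbolic: in any triple of points the two smallest merging heights
  coincide. The instances cover all four triples with each choice of middle point.\<close>

lemma tree_product_ultra:
  assumes "p \<in> carrier \<Gamma>" "x \<in> carrier \<Gamma>" "y \<in> carrier \<Gamma>" "z \<in> carrier \<Gamma>"
  shows "min (tree_product p x y) (tree_product p y z) \<le> tree_product p x z"
proof -
  note u = merge_ultra
  note s = merge_sym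
  show ?thesis
    using u[of p x y] u[of x p y] u[of p y x] u[of p y z] u[of y p z] u[of p z y]
      u[of p x z] u[of x p z] u[of p z x] u[of x y z] u[of y x z] u[of x z y]
      s[of p x] s[of p y] s[of p z] s[of x y] s[of y z] s[of x z] assms
    unfolding tree_product_def by (smt (verit))
qed

lemma horo_gens_hyperbolic: "gromov_hyperbolic (carrier \<Gamma>) (cayley_dist \<Gamma> X)"
  unfolding gromov_hyperbolic_def
\<comment> \<open>An error of 1 from the upper bounds plus 1/2 from the lower bound.\<close>
proof (intro exI[of _ "3/2"] conjI ballI)
  fix p x y z assume c: "p \<in> carrier \<Gamma>" "x \<in> carrier \<Gamma>" "y \<in> carrier \<Gamma>" "z \<in> carrier \<Gamma>"
  let ?T = "\<lambda>x y. real_of_int (tree_product p x y)"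
  have "min (?T x y) (?T y z) \<le> ?T x z" using tree_product_ultra[OF c] by linarith
  then show "min (gromov_product (cayley_dist \<Gamma> X) p x y) (gromov_product (cayley_dist \<Gamma> X) p y z) - 3/2
      \<le> gromov_product (cayley_dist \<Gamma> X) p x z"
    using gromov_product_bounds[OF c(1,2,3)] gromov_product_bounds[OF c(1,3,4)]
      gromov_product_bounds[OF c(1,2,4)] by linarith
qed auto

section \<open>The fixed end and the other boundary points\<close>

lemma gromov_sequenceI:
  assumes "\<And>n. x n \<in> carrier \<Gamma>" "\<And>i j. int (min i j) \<le> tree_product \<one>\<^bsub>\<Gamma>\<^esub> (x i) (x j)"
  shows "x \<in> gromov_sequences (carrier \<Gamma>) (cayley_dist \<Gamma> X) \<one>\<^bsub>\<Gamma>\<^esub>"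
proof -
  have "\<exists>N. \<forall>i\<ge>N. \<forall>j\<ge>N. gromov_product (cayley_dist \<Gamma> X) \<one>\<^bsub>\<Gamma>\<^esub> (x i) (x j) \<ge> K" for K
  proof -
    have "gromov_product (cayley_dist \<Gamma> X) \<one>\<^bsub>\<Gamma>\<^esub> (x i) (x j) \<ge> K"
      if "i \<ge> nat \<lceil>K + 1\<rceil>" "j \<ge> nat \<lceil>K + 1\<rceil>" for i j
    proof -
      have "K + 1 \<le> real (min i j)" using that by linarith
      also have "\<dots> \<le> of_int (tree_product \<one>\<^bsub>\<Gamma>\<^esub> (x i) (x j))"
        using assms(2)[of i j] by linarith
      finally show ?thesis
        using gromov_product_bounds(1)[OF W.one_closed assms(1) assms(1), of i j] by linarith
    qed
    then show ?thesis by blast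
  qed
  then show ?thesis using assms(1) by (auto simp: gromov_sequences_def)
qed

lemma descending_sequence:
  "(\<lambda>n. (\<lambda>_. \<one>, - int n)) \<in> gromov_sequences (carrier \<Gamma>) (cayley_dist \<Gamma> X) \<one>\<^bsub>\<Gamma>\<^esub>"
proof (rule gromov_sequenceI)
  fix i j
  let ?x = "\<lambda>n::nat. (\<lambda>_::int. \<one>, - int n)"
  have "merge \<one>\<^bsub>\<Gamma>\<^esub> (?x i) \<le> - int i" "merge \<one>\<^bsub>\<Gamma>\<^esub> (?x j) \<le> - int j"
    using merge_le(2)[of _ "?x i"] merge_le(2)[of _ "?x j"] by simp_all
  moreover have "min (- int i) (- int j) \<le> merge (?x i) (?x j)"
    by (rule le_mergeI) (auto simp: agree_refl)
  \<comment> \<open>The folded \<open>snd_conv\<close> says that the identity has height 0 and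
    leaves the identity inside \<open>merge\<close> folded.\<close>
  ultimately show "int (min i j) \<le> tree_product \<one>\<^bsub>\<Gamma>\<^esub> (?x i) (?x j)"
    unfolding tree_product_def using snd_conv[of "\<lambda>_::int. \<one>" "0::int", folded one_wreath]
    by linarith
qed (auto simp: carrier_wreath)

text \<open>Far enough down, the lamps of \<open>a\<close> are no longer seen, and \<open>a\<close>
  acts there as a change of height by \<open>i\<close>.\<close>

lemma descending_near:
  assumes "a \<in> carrier \<Gamma>"
  shows "\<exists>C J. \<forall>j\<ge>J. cayley_dist \<Gamma> X (a \<otimes>\<^bsub>\<Gamma>\<^esub> (\<lambda>_. \<one>, - int j)) (\<lambda>_. \<one>, - int j) \<le> C"
proof -
  obtain f i where a: "a = (f, i)" "f \<in> lamps G" using assms by (auto simp: carrier_wreath)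
  obtain n :: nat where n: "agree (i - int n) f (\<lambda>_. \<one>)" using agree_exists[OF a(2) lamps_one] by blast
  \<comment> \<open>The choice of \<open>j\<close> puts the lower of the two heights below the
    agreement level \<open>i - int n\<close>; the \<open>+ 1\<close> is the cost of passing from the
    tree to the Cayley graph.\<close>
  have "cayley_dist \<Gamma> X (a \<otimes>\<^bsub>\<Gamma>\<^esub> (\<lambda>_. \<one>, - int j)) (\<lambda>_. \<one>, - int j) \<le> of_int (\<bar>i\<bar> + 1)"
    if j: "j \<ge> n + nat \<bar>i\<bar>" for j
  proof -
    let ?p = "(f, i - int j)" and ?q = "(\<lambda>_::int. \<one>, - int j)"
    have "min (i - int j) (- int j) \<le> merge ?p ?q"
      by (rule le_mergeI) (use j in \<open>auto intro!: agree_mono[OF n]\<close>)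
    then have "tree_dist ?p ?q \<le> \<bar>i\<bar>" unfolding tree_dist_def by simp
    moreover have "a \<otimes>\<^bsub>\<Gamma>\<^esub> ?q = ?p" using a by (auto simp: mult_wreath)
    ultimately show ?thesis
      using cayley_dist_bounds(2)[of ?p ?q] a by (simp add: carrier_wreath)
  qed
  then show ?thesis by blast
qed

text \<open>The rays \<open>x m\<close> climb from the identity with a single lamp \<open>c\<close>
  at position \<open>m\<close>; two such rays separate at a bounded height because \<open>c\<close>
  is outside \<open>H\<close>.\<close>

lemma infinite_boundary:
  assumes "H \<noteq> carrier G"
  shows "infinite (gromov_boundary (carrier \<Gamma>) (cayley_dist \<Gamma> X) \<one>\<^bsub>\<Gamma>\<^esub>)"
proof -
  let ?S = "gromov_sequences (carrier \<Gamma>) (cayley_dist \<Gamma> X) \<one>\<^bsub>\<Gamma>\<^esub>"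
  let ?R = "gromov_rel (carrier \<Gamma>) (cayley_dist \<Gamma> X) \<one>\<^bsub>\<Gamma>\<^esub>"
  obtain c where c: "c \<in> carrier G" "c \<notin> H" using assms subset by blast
  define f where "f = (\<lambda>m::nat. \<lambda>x::int. if x = int m then c else \<one>)"
  define x where "x = (\<lambda>m n. (f m, int n))"
  have f: "f m \<in> lamps G" for m using c by (simp add: f_def)
  have xc: "x m n \<in> carrier \<Gamma>" for m n using f by (simp add: x_def carrier_wreath)
  \<comment> \<open>The configurations are trivial at negative positions, so all rays pass through
    the tree vertex of the identity and Gromov products are merging heights.\<close>
  have merge_one: "merge \<one>\<^bsub>\<Gamma>\<^esub> (x m n) = 0" for m n
  proof (rule antisym)
    show "0 \<le> merge \<one>\<^bsub>\<Gamma>\<^esub> (x m n)"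
      by (rule le_mergeI) (auto simp: agree_def one_wreath x_def f_def)
  qed (use merge_le(1)[of "\<one>\<^bsub>\<Gamma>\<^esub>" "x m n"] in \<open>simp add: one_wreath\<close>)
  then have prod: "tree_product \<one>\<^bsub>\<Gamma>\<^esub> (x m i) (x m' j) = merge (x m i) (x m' j)" for m m' i j
    by (simp add: tree_product_def one_wreath)
  have seq: "x m \<in> ?S" for m
  proof (rule gromov_sequenceI)
    show "int (min i j) \<le> tree_product \<one>\<^bsub>\<Gamma>\<^esub> (x m i) (x m j)" for i j
      unfolding prod by (rule le_mergeI) (auto simp: x_def f agree_refl)
  qed (rule xc)
  have bounded: "merge (x m i) (x m' j) \<le> int m" if "m \<noteq> m'" for m m' i j
  proof (rule ccontr)
    assume "\<not> ?thesis"
    then have "inv (f m (int m)) \<otimes> f m' (int m) \<in> H"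
      using agree_merge[OF xc xc, of m i m' j] unfolding agree_def x_def by simp
    then have "inv c \<in> H" using that c by (simp add: f_def)
    then have "inv (inv c) \<in> H" by blast
    then show False using c by simp
  qed
  have "inj (\<lambda>m. ?R `` {x m})"
  proof (rule injI, rule ccontr)
    fix m m' assume eq: "?R `` {x m} = ?R `` {x m'}" and ne: "m \<noteq> m'"
    have "(x m', x m') \<in> ?R" using seq[of m'] by (auto simp: gromov_rel_def gromov_sequences_def)
    then have "(x m, x m') \<in> ?R" using eq by blast
    \<comment> \<open>The product is at most the merging height plus 1, hence at most
      \<open>m + 1\<close>; the bound \<open>m + 2\<close> is out of reach.\<close>
    then have "\<exists>N. \<forall>i\<ge>N. \<forall>j\<ge>N.
        gromov_product (cayley_dist \<Gamma> X) \<one>\<^bsub>\<Gamma>\<^esub> (x m i) (x m' j) \<ge> real m + 2"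
      by (simp add: gromov_rel_def)
    then obtain N where "\<And>i j. i \<ge> N \<Longrightarrow> j \<ge> N \<Longrightarrow>
        gromov_product (cayley_dist \<Gamma> X) \<one>\<^bsub>\<Gamma>\<^esub> (x m i) (x m' j) \<ge> real m + 2"
      by blast
    then have "gromov_product (cayley_dist \<Gamma> X) \<one>\<^bsub>\<Gamma>\<^esub> (x m N) (x m' N) \<ge> real m + 2" by blast
    moreover have "real_of_int (merge (x m N) (x m' N)) \<le> real m"
      using bounded[OF ne, of N N] by linarith
    ultimately show False
      using gromov_product_bounds(2)[OF W.one_closed xc xc, of m N m' N] unfolding prod by linarith
  qed
  then have "infinite (range (\<lambda>m. ?R `` {x m}))" by (rule range_inj_infinite)
  moreover have "range (\<lambda>m. ?R `` {x m}) \<subseteq> gromov_boundary (carrier \<Gamma>) (cayley_dist \<Gamma> X) \<one>\<^bsub>\<Gamma>\<^esub>"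
    unfolding gromov_boundary_def using seq by (auto intro: quotientI)
  ultimately show ?thesis using finite_subset by blast
qed

text \<open>Left translation is transitive on vertices, so every boundary point is a limit point of
  the orbit.\<close>

lemma limit_points_orbit:
  "limit_points (carrier \<Gamma>) (cayley_dist \<Gamma> X) \<one>\<^bsub>\<Gamma>\<^esub> (orbit \<Gamma> (left_translation \<Gamma>) \<one>\<^bsub>\<Gamma>\<^esub>)
    = gromov_boundary (carrier \<Gamma>) (cayley_dist \<Gamma> X) \<one>\<^bsub>\<Gamma>\<^esub>"
proof -
  have "orbit \<Gamma> (left_translation \<Gamma>) \<one>\<^bsub>\<Gamma>\<^esub> = carrier \<Gamma>"
    by (force simp: orbit_def left_translation_def)
  moreover have "\<exists>x\<in>\<xi>. range x \<subseteq> carrier \<Gamma>"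
    if \<xi>: "\<xi> \<in> gromov_boundary (carrier \<Gamma>) (cayley_dist \<Gamma> X) \<one>\<^bsub>\<Gamma>\<^esub>" for \<xi>
  proof -
    obtain x where "\<xi> = gromov_rel (carrier \<Gamma>) (cayley_dist \<Gamma> X) \<one>\<^bsub>\<Gamma>\<^esub> `` {x}"
      and x: "x \<in> gromov_sequences (carrier \<Gamma>) (cayley_dist \<Gamma> X) \<one>\<^bsub>\<Gamma>\<^esub>"
      using \<xi> unfolding gromov_boundary_def by (rule quotientE)
    then have "x \<in> \<xi>" by (simp add: gromov_rel_def gromov_sequences_def)
    then show ?thesis using x by (intro bexI[of _ x]) (simp_all add: gromov_sequences_def)
  qed
  ultimately show ?thesis unfolding limit_points_def by auto
qed

theorem horo_gens_quasi_parabolic: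
  assumes "H \<noteq> carrier G"
  shows "quasi_parabolic_generating_set \<Gamma> X"
  unfolding quasi_parabolic_generating_set_def hyperbolic_generating_set_def limit_points_orbit
  using horo_gens_generating horo_gens_hyperbolic infinite_boundary[OF assms]
    W.boundary_point_fixed[OF horo_gens_generating horo_gens_hyperbolic descending_sequence
      descending_near] descending_sequence
  by (auto simp: gromov_boundary_def intro!: bexI[OF _ quotientI])

section \<open>Word lengths and the order on the generating sets\<close>

lemma word_length_single:
  assumes "c \<in> carrier G" "c \<notin> H"
  shows "2 * n \<le> word_length \<Gamma> X (\<lambda>x. if x = - int n then c else \<one>, 0)"
proof -
  let ?g = "(\<lambda>x. if x = - int n then c else \<one>, 0)"
  have g: "?g \<in> carrier \<Gamma>" using assms by (simp add: carrier_wreath)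
  \<comment> \<open>A higher merging level would force agreement at position \<open>- int n\<close>,
    where the quotient is \<open>c\<close>. A path must therefore descend \<open>n\<close> levels
    and climb back.\<close>
  have "merge \<one>\<^bsub>\<Gamma>\<^esub> ?g \<le> - int n"
  proof (rule ccontr)
    assume "\<not> ?thesis"
    then have "inv \<one> \<otimes> c \<in> H"
      using agree_merge[OF W.one_closed g] unfolding agree_def one_wreath
      by (auto dest: spec[of _ "- int n"])
    then show False using assms by simp
  qed
  then have "2 * int n \<le> tree_dist \<one>\<^bsub>\<Gamma>\<^esub> ?g" by (simp add: tree_dist_def one_wreath)
  also have "real_of_int \<dots> \<le> real (word_length \<Gamma> X ?g)"
    using cayley_dist_bounds(1)[OF W.one_closed g]
      W.cayley_dist_eq_word_length[OF horo_gens_carrier W.one_closed g] g by simp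
  finally show ?thesis by linarith
qed

end

text \<open>A smaller subgroup gives a smaller generating set. Conversely, a lamp \<open>c\<close>
  in \<open>K\<close> but not in \<open>H\<close> is a generator at any negative position, yet its
  length for \<open>H\<close> grows with the depth.\<close>

lemma gen_le_horo_gens_iff:
  assumes "group G" "subgroup H G" "subgroup K G"
  shows "gen_le (restricted_wreath G integer_group) (horo_gens G H) (horo_gens G K) \<longleftrightarrow> K \<subseteq> H"
proof -
  interpret H: wreath_tree G H using assms by (simp add: wreath_tree_def)
  interpret K: wreath_tree G K using assms by (simp add: wreath_tree_def)
  show ?thesis
  proof
    assume "K \<subseteq> H"
    then have "horo_gens G K \<subseteq> horo_gens G H" unfolding horo_gens_def by blast
    then show "gen_le H.\<Gamma> (horo_gens G H) (horo_gens G K)"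
      using H.W.gen_le_refl[OF H.horo_gens_generating] unfolding gen_le_def
      by (meson bdd_above_mono image_mono)
  next
    assume "gen_le H.\<Gamma> (horo_gens G H) (horo_gens G K)"
    then obtain N where N: "\<And>y. y \<in> horo_gens G K \<Longrightarrow> word_length H.\<Gamma> (horo_gens G H) y \<le> N"
      by (auto simp: gen_le_def bdd_above_def)
    show "K \<subseteq> H"
    proof (rule ccontr)
      assume "\<not> K \<subseteq> H"
      then obtain c where c: "c \<in> K" "c \<notin> H" by blast
      \<comment> \<open>\<open>Suc N\<close> makes the position negative even for
        \<open>N = 0\<close> and the length at least \<open>2 * Suc N\<close>, which exceeds
        \<open>N\<close>.\<close>
      let ?g = "(\<lambda>x::int. if x = - int (Suc N) then c else \<one>\<^bsub>G\<^esub>, 0)"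
      have "?g \<in> horo_gens G K" using c K.subset by (auto simp: horo_gens_def)
      then show False using N[of ?g] H.word_length_single[of c "Suc N"] c K.subset by fastforce
    qed
  qed
qed


section \<open>Subgroups of the free group of rank two\<close>

abbreviation "F2 \<equiv> free_group (UNIV :: bool set)"

text \<open>The free group acts on \<open>int \<times> bool\<close> through the lamplighter group.\<close>

fun letter_act :: "bool \<times> bool \<Rightarrow> int \<times> bool \<Rightarrow> int \<times> bool"
  where
    "letter_act (True, e) (n, b) = (if e then n + 1 else n - 1, b)"
  | "letter_act (False, e) (n, b) = (n, if n = 0 then \<not> b else b)"

lemma letter_act_inv: "letter_act l (letter_act (letter_inv l) p) = p"
  by (cases l; cases p; cases "fst l") (auto simp: letter_inv_def)

text \<open>A cancelled pair of letters acts trivially, so acting by words is compatible with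
  reduction.\<close>

lemma foldr_letter_act_push: "foldr letter_act (push_letter l w) p = letter_act l (foldr letter_act w p)"
  by (cases w) (auto simp: letter_act_inv)

lemma foldr_letter_act_mult:
  "foldr letter_act (foldr push_letter u v) p = foldr letter_act u (foldr letter_act v p)"
  by (induction u) (auto simp: foldr_letter_act_push)

text \<open>A pointwise stabiliser, with the number \<open>n\<close> placed at
  \<open>(int n, False)\<close>.\<close>

definition stab :: "nat set \<Rightarrow> (bool \<times> bool) list set"
  where "stab A = {w \<in> carrier F2. \<forall>n\<in>A. foldr letter_act w (int n, False) = (int n, False)}"

lemma subgroup_stab: "subgroup (stab A) F2"
proof -
  interpret group F2 by (rule group_free_group)
  have act_mult: "foldr letter_act (u \<otimes>\<^bsub>F2\<^esub> v) p = foldr letter_act u (foldr letter_act v p)" for u v p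
    by (simp add: free_group_def foldr_letter_act_mult)
  have act_one: "foldr letter_act \<one>\<^bsub>F2\<^esub> p = p" for p by (simp add: free_group_def)
  show ?thesis
  proof (rule subgroupI)
    have "\<one>\<^bsub>F2\<^esub> \<in> stab A" using act_one by (simp add: stab_def)
    then show "stab A \<noteq> {}" by blast
  next
    fix w assume w: "w \<in> stab A"
    have "foldr letter_act (inv\<^bsub>F2\<^esub> w) (int n, False) = (int n, False)" if "n \<in> A" for n
      using act_mult[of "inv\<^bsub>F2\<^esub> w" w "(int n, False)"] w that act_one by (simp add: stab_def)
    then show "inv\<^bsub>F2\<^esub> w \<in> stab A" using w by (simp add: stab_def)
  next
    fix u v assume "u \<in> stab A" "v \<in> stab A"
    then show "u \<otimes>\<^bsub>F2\<^esub> v \<in> stab A" by (simp add: stab_def act_mult)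
  qed (auto simp: stab_def)
qed

text \<open>The toggle at 0 conjugated by a power of the shift. Since \<open>foldr\<close> applies
  the last letter first, a point is moved down by \<open>m\<close>, toggled at 0 and moved
  back.\<close>

lemma exists_flip_at:
  "\<exists>w\<in>carrier F2. \<forall>n b. foldr letter_act w (n, b) = (n, if n = int m then \<not> b else b)"
proof -
  let ?u = "replicate m (True, True) @ (False, True) # replicate m (True, False)"
  have up: "foldr letter_act (replicate k (True, True)) (n, b) = (n + int k, b)" for k n b
    by (induction k arbitrary: n) (auto simp del: foldr_replicate)
  have down: "foldr letter_act (replicate k (True, False)) (n, b) = (n - int k, b)" for k n b
    by (induction k arbitrary: n) (auto simp del: foldr_replicate)
  \<comment> \<open>Pushing onto the empty word reduces \<open>?u\<close> and so yields an element
    of the carrier.\<close>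
  have "foldr push_letter ?u [] \<in> carrier F2"
    unfolding free_group_def partial_object.select_convs
    by (rule foldr_push_reduced) (auto simp: reduced_words_def)
  moreover have "foldr letter_act (foldr push_letter ?u []) (n, b) = (n, if n = int m then \<not> b else b)"
    for n b by (simp only: foldr_letter_act_mult) (simp add: up down del: foldr_replicate)
  ultimately show ?thesis by blast
qed

text \<open>The flip at a point \<open>m\<close> of \<open>B\<close> outside \<open>A\<close> fixes
  all points of \<open>A\<close> but moves that of \<open>m\<close>.\<close>

lemma stab_subset_iff: "stab A \<subseteq> stab B \<longleftrightarrow> B \<subseteq> A"
proof
  assume sub: "stab A \<subseteq> stab B"
  show "B \<subseteq> A"
  proof (rule ccontr)
    assume "\<not> B \<subseteq> A"
    then obtain m where m: "m \<in> B" "m \<notin> A" by blast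
    obtain w where "w \<in> carrier F2"
      "\<And>n b. foldr letter_act w (n, b) = (n, if n = int m then \<not> b else b)"
      using exists_flip_at by blast
    then have "w \<in> stab A" "w \<notin> stab B" using m by (auto simp: stab_def)
    then show False using sub by blast
  qed
qed (auto simp: stab_def)


section \<open>Copies of the power set of the natural numbers\<close>

text \<open>Lower cuts of the reals, transported to sets of naturals by an enumeration of the
  rationals.\<close>

lemma uncountable_chain_nat_sets:
  "\<exists>C :: nat set set. Complete_Partial_Order.chain (\<subseteq>) C \<and> uncountable C"
proof -
  define cut where "cut r = {n. real_of_rat (from_nat_into UNIV n) < r}" for r :: real
  have mono: "cut r \<subseteq> cut s" if "r \<le> s" for r s using that by (auto simp: cut_def)
  have "\<not> cut s \<subseteq> cut r" if "r < s" for r s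
  proof -
    obtain q where q: "r < real_of_rat q" "real_of_rat q < s" using of_rat_dense \<open>r < s\<close> by blast
    obtain n where "from_nat_into UNIV n = q"
      using from_nat_into_surj[of "UNIV :: rat set" q] by auto
    then have "n \<in> cut s" "n \<notin> cut r" using q by (auto simp: cut_def)
    then show ?thesis by blast
  qed
  then have "inj cut" by (metis injI linorder_neqE subset_refl)
  then have "uncountable (range cut)"
    using countable_image_inj_eq uncountable_UNIV_real by blast
  moreover have "Complete_Partial_Order.chain (\<subseteq>) (range cut)"
    by (rule chainI) (metis imageE linear mono)
  ultimately show ?thesis by blast
qed

lemma uncountable_chain_of_isomorphic_copy:
  fixes Q :: "'a set"
  assumes "contains_isomorphic_copy Q leQ (UNIV :: nat set set) (\<subseteq>)"
  shows "\<exists>C\<subseteq>Q. Complete_Partial_Order.chain leQ C \<and> uncountable C"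
proof -
  obtain f :: "nat set \<Rightarrow> 'a"
    where f: "f \<in> UNIV \<rightarrow> Q" "inj f" "\<And>x y. leQ (f x) (f y) \<longleftrightarrow> x \<subseteq> y"
    using assms unfolding contains_isomorphic_copy_def by (elim bexE conjE) simp
  obtain C :: "nat set set" where C: "Complete_Partial_Order.chain (\<subseteq>) C" "uncountable C"
    using uncountable_chain_nat_sets by blast
  have "uncountable (f ` C)"
    using C(2) f(2) countable_image_inj_on inj_on_subset by blast
  moreover have "Complete_Partial_Order.chain leQ (f ` C)"
    using C(1) f(3) by (auto simp: chain_def)
  ultimately show ?thesis using f(1) by (intro exI[of _ "f ` C"]) auto
qed

theorem corollary1p5:
  fixes \<Gamma> :: "((int \<Rightarrow> (bool \<times> bool) list) \<times> int) monoid"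
  defines "\<Gamma> \<equiv> restricted_wreath (free_group (UNIV :: bool set)) integer_group"
  shows "contains_isomorphic_copy
           (quasi_parabolic_structures \<Gamma>) (structure_le \<Gamma>) (UNIV :: nat set set) (\<subseteq>)
         \<and> (\<exists>C \<subseteq> quasi_parabolic_structures \<Gamma>.
              Complete_Partial_Order.chain (structure_le \<Gamma>) C \<and> uncountable C)"
proof -
  interpret group \<Gamma>
    unfolding \<Gamma>_def by (intro group_restricted_wreath group_free_group group_integer_group)
  \<comment> \<open>The extra point 0 keeps the stabiliser proper even for empty \<open>A\<close>;
    the shift by \<open>Suc\<close> frees 0 so that inclusions are still reflected.\<close>
  define Y where "Y A = horo_gens F2 (stab (insert 0 (Suc ` A)))" for A
  \<comment> \<open>Two reversals cancel: larger sets have smaller stabilisers, and smaller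
    subgroups give larger structures.\<close>
  have le: "gen_le \<Gamma> (Y A) (Y B) \<longleftrightarrow> A \<subseteq> B" for A B
  proof -
    have "insert 0 (Suc ` A) \<subseteq> insert 0 (Suc ` B) \<longleftrightarrow> A \<subseteq> B" by auto
    then show ?thesis
      unfolding \<Gamma>_def Y_def
      by (simp add: gen_le_horo_gens_iff group_free_group subgroup_stab stab_subset_iff)
  qed
  have qp: "quasi_parabolic_generating_set \<Gamma> (Y A)" for A
  proof -
    have "wreath_tree F2 (stab (insert 0 (Suc ` A)))"
      by (simp add: wreath_tree_def group_free_group subgroup_stab)
    moreover have "stab (insert 0 (Suc ` A)) \<noteq> carrier F2"
    proof -
      have "stab {} = carrier F2" by (simp add: stab_def)
      then show ?thesis using stab_subset_iff[of "{}" "insert 0 (Suc ` A)"] by auto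
    qed
    ultimately show ?thesis
      unfolding \<Gamma>_def Y_def by (rule wreath_tree.horo_gens_quasi_parabolic)
  qed
  then have gen: "Y A \<in> generating_sets \<Gamma>" for A
    by (auto simp: quasi_parabolic_generating_set_def hyperbolic_generating_set_def)
  have "contains_isomorphic_copy
      (quasi_parabolic_structures \<Gamma>) (structure_le \<Gamma>) (UNIV :: nat set set) (\<subseteq>)"
    unfolding contains_isomorphic_copy_def
  proof (intro bexI[of _ "\<lambda>A. gen_class \<Gamma> (Y A)"] conjI ballI)
    show "inj (\<lambda>A. gen_class \<Gamma> (Y A))"
      by (rule injI) (auto simp: gen_class_eq_iff gen le)
    show "(\<lambda>A. gen_class \<Gamma> (Y A)) \<in> UNIV \<rightarrow> quasi_parabolic_structures \<Gamma>"
      using qp by (auto simp: quasi_parabolic_structures_def)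
  qed (simp add: structure_le_gen_class gen le)
  then show ?thesis using uncountable_chain_of_isomorphic_copy by blast
qed

end
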